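(* Let $\ell$ be a positive integer. For $\sigma\in\{0,1\}$ and $n\in\mathbb N$ let $r^\ell_\sigma(n)$ be the number of $\boldsymbol\sigma=(\sigma_1,\dots,\sigma_\ell)\in\mathbb Z^\ell$ with $\sigma_1+\dots+\sigma_\ell=\sigma$ and $\mathrm{rk}(\boldsymbol\sigma)=n$. Then: (1) $r^\ell_1(n)>0$ for all $n\in\mathbb N$ if and only if $\ell\ge4$; (2) $r^\ell_0(n)>0$ for all $n\in\mathbb N$ if and only if $\ell\ge5$.
   Context: $\mathbb N=\{0,1,2,\dots\}$. For $\boldsymbol\sigma\in\mathbb Z^\ell$, the rank is $\mathrm{rk}(\boldsymbol\sigma)=\left\lceil\frac{Y-\ell+1}{2\ell}\right\rceil$ where $Y=\sum_{i=1}^{\ell}\sum_{j\ne i}\sigma_i(\sigma_i-\sigma_j)$. *)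

theory Defs
  imports Complex_Main "HOL-Library.FuncSet"
begin

definition int_vecs :: "nat \<Rightarrow> (nat \<Rightarrow> int) set" where
  "int_vecs l = ({1..l} \<rightarrow>\<^sub>E UNIV)"

definition rk_Y :: "nat \<Rightarrow> (nat \<Rightarrow> int) \<Rightarrow> int" where
  "rk_Y l \<sigma> = (\<Sum>i\<in>{1..l}. \<Sum>j\<in>{1..l} - {i}. \<sigma> i * (\<sigma> i - \<sigma> j))"

definition rk :: "nat \<Rightarrow> (nat \<Rightarrow> int) \<Rightarrow> int" where
  "rk l \<sigma> = \<lceil>real_of_int (rk_Y l \<sigma> - int l + 1) / (2 * real l)\<rceil>"

(* For l \<ge> 1 the counted set is finite: if the entries of \<sigma> sum to s, then
   rk_Y l \<sigma> = l * (\<Sum>i\<in>{1..l}. (\<sigma> i)^2) - s^2. So card is the true count. *)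
definition rank_count :: "nat \<Rightarrow> int \<Rightarrow> nat \<Rightarrow> nat" where
  "rank_count l s n =
     card {\<sigma> \<in> int_vecs l. (\<Sum>i\<in>{1..l}. \<sigma> i) = s \<and> rk l \<sigma> = int n}"

end

theory Submission
  imports Defs "HOL-Analysis.Analysis" "HOL-Computational_Algebra.Formal_Power_Series"
begin

text \<open>
Write \<open>Q\<close> for the sum of the squares of the entries. For entry sum \<open>s \<in> {0, 1}\<close> the rank is \<open>(Q - s) / 2\<close>,
so the question is which integers of the right parity are sums of \<open>l\<close> squares of integers with sum \<open>s\<close>.
Failure for small \<open>l\<close> comes from the fact that \<open>7\<close> and \<open>28\<close> are not sums of three squares. The positive
part reduces to \<open>l = 4\<close>, \<open>s = 1\<close> by appending zeros, or \<open>-1\<close> and zeros. There, an orthogonal change of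
variables shows that the claim is Gauss's theorem that every natural number is a sum of three
triangular numbers (\<open>sum_of_three_triangular\<close>).

That theorem follows from a formula for the number of representations. Let \<open>\<theta>\<close> be the generating series
of the triangular numbers. The number of representations of \<open>m\<close> by three triangular numbers equals the
number of triples of odd positive integers with \<open>A B + B C + C A = 8 m + 3\<close>, which is positive because of
\<open>(1, 1, 4 m + 1)\<close>. To prove the equality, both series are multiplied by \<open>\<theta>\<close> and both products are shown
to be the generating series of the divisor sums \<open>\<sigma>(2 n + 1)\<close>.

For \<open>\<theta>\<^sup>4\<close> (\<open>sigma_fps_eq\<close>), the differential equation of a fourth power is a recurrence for the
coefficients, and the divisor sums satisfy it by an argument with Zagier's windmill involution
(\<open>windmill_sum\<close>).

For the triples (\<open>triangular_times_triples\<close>), one has to count the solutions of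
\<open>X\<^sup>2 + A B + B C + C A = 4 N\<close> in odd integers with \<open>A, B, C > 0\<close>, where \<open>N\<close> is odd. Such a solution is an
integer matrix of determinant \<open>N\<close> and trace \<open>X\<close> whose fixed point in the hyperbolic plane lies in an ideal
triangle \<open>T\<close> and has triangle coordinates proportional to \<open>A, B, C\<close>; modulo \<open>2\<close> the matrix has order
\<open>3\<close>. Such matrices fall into \<open>2 \<sigma>(N)\<close> cosets of the congruence subgroup of level \<open>2\<close>, and each coset
contains exactly one whose fixed point lies in \<open>T\<close>. Uniqueness (\<open>elliptic_rigid\<close>) is a parity argument
with distances. Existence (\<open>elliptic_member\<close>) is a fixed point theorem: folding the plane along the
reflections in the sides of \<open>T\<close> turns the coset into a distance-nonincreasing map of \<open>T\<close> to itself that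
permutes the three cusps cyclically, and a point of least displacement must be fixed.
\<close>

unbundle fps_syntax

section \<open>The hyperbolic plane and its isometries\<close>

lemma abs_le_power2_int: "\<bar>x\<bar> \<le> x^2" for x :: int
proof (cases "x = 0")
  case False
  then have "\<bar>x\<bar> * 1 \<le> \<bar>x\<bar> * \<bar>x\<bar>" by (intro mult_left_mono) auto
  then show ?thesis by (simp add: power2_eq_square flip: abs_mult)
qed simp

lemma one_le_odd_power2: "1 \<le> w^2" if "odd w" for w :: int
proof -
  have "w \<noteq> 0" using that by auto
  then show ?thesis by (metis int_one_le_iff_zero_less zero_less_power2)
qed

type_synonym form = "real \<times> real \<times> real"
type_synonym imat = "int \<times> int \<times> int \<times> int"

text \<open>
The triple \<open>(p, q, r)\<close> stands for the symmetric matrix \<open>S\<close> with rows \<open>(p, -q)\<close> and \<open>(-q, r)\<close>. The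
positive definite ones, up to scaling, are the points of the hyperbolic plane. The pairing is the
polar form of the determinant (\<open>pairing S S = 2 det S\<close>), so for matrices of determinant \<open>1\<close> it is
twice the hyperbolic cosine of the distance.
\<close>

fun pairing :: "form \<Rightarrow> form \<Rightarrow> real" where
  "pairing (p, q, r) (p', q', r') = p * r' + r * p' - 2 * q * q'"

text \<open>
The integer matrix \<open>M\<close> with rows \<open>(u, y)\<close> and \<open>(a, v)\<close> acts by \<open>S \<mapsto> M S M\<^sup>T / N\<close>. For
\<open>det M = \<plusminus>N\<close> this is an isometry of the hyperbolic plane, orientation-preserving for the sign \<open>+\<close>.
\<close>

fun act :: "real \<Rightarrow> imat \<Rightarrow> form \<Rightarrow> form" where
  "act N (u, y, a, v) (p, q, r) =
    ((u^2 * p - 2 * u * y * q + y^2 * r) / N,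
     ((u * v + y * a) * q - u * a * p - y * v * r) / N,
     (a^2 * p - 2 * a * v * q + v^2 * r) / N)"

fun idet :: "imat \<Rightarrow> int" where
  "idet (u, y, a, v) = u * v - y * a"

text \<open>
These are the matrices that permute the three nonzero vectors modulo \<open>2\<close> cyclically, that is, whose
reduction modulo \<open>2\<close> has order \<open>3\<close>.
\<close>

fun rotating :: "imat \<Rightarrow> bool" where
  "rotating (u, y, a, v) \<longleftrightarrow> odd a \<and> odd y \<and> odd (u + v)"

text \<open>
With \<open>\<xi>\<^sub>1 = (1, 0)\<close>, \<open>\<xi>\<^sub>2 = (0, 1)\<close>, \<open>\<xi>\<^sub>3 = (1, -1)\<close> one has
\<open>S = (p - q) \<xi>\<^sub>1\<xi>\<^sub>1\<^sup>T + (r - q) \<xi>\<^sub>2\<xi>\<^sub>2\<^sup>T + q \<xi>\<^sub>3\<xi>\<^sub>3\<^sup>T\<close>. Nonnegativity of these three coordinates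
describes the ideal triangle whose cusps are the \<open>\<xi>\<^sub>i\<close>.
\<close>

fun in_triangle :: "form \<Rightarrow> bool" where
  "in_triangle (p, q, r) \<longleftrightarrow> 0 \<le> q \<and> q \<le> p \<and> q \<le> r"

text \<open>
Left multiplication by the reflections in the three sides of the ideal triangle. They are integer
matrices of determinant \<open>-1\<close> that are trivial modulo \<open>2\<close>.
\<close>

fun refl1 :: "imat \<Rightarrow> imat" where
  "refl1 (u, y, a, v) = (- u, - y, a + 2 * u, v + 2 * y)"
fun refl2 :: "imat \<Rightarrow> imat" where
  "refl2 (u, y, a, v) = (u + 2 * a, y + 2 * v, - a, - v)"
fun refl3 :: "imat \<Rightarrow> imat" where
  "refl3 (u, y, a, v) = (u, y, - a, - v)"

lemma pairing_act:
  assumes "(of_int (idet M))^2 = N^2" "N \<noteq> 0"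
  shows "pairing (act N M S) (act N M S') = pairing S S'"
proof -
  obtain u y a v where M: "M = (u, y, a, v)" by (metis surj_pair)
  obtain p q r where S: "S = (p, q, r)" by (metis surj_pair)
  obtain p' q' r' where S': "S' = (p', q', r')" by (metis surj_pair)
  define U Y A V where d: "U = real_of_int u" "Y = real_of_int y" "A = real_of_int a" "V = real_of_int v"
  have e: "(U * V - Y * A)^2 = N^2" using assms(1) unfolding M d by (simp flip: of_int_mult of_int_diff of_int_power)
  have "pairing (act N M S) (act N M S') * N^2 = (U * V - Y * A)^2 * pairing S S'"
    using assms(2) unfolding M S S' d
    apply (simp add: divide_simps)
    apply (simp add: power2_eq_square algebra_simps)
    done
  then show ?thesis using e assms(2) by simp
qed

lemma pairing_add: "pairing (S + S') T = pairing S T + pairing S' T"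
  by (cases S; cases S'; cases T) (simp add: algebra_simps)
lemma pairing_diff: "pairing (S - S') T = pairing S T - pairing S' T"
  by (cases S; cases S'; cases T) (simp add: algebra_simps)
lemma pairing_diff': "pairing T (S - S') = pairing T S - pairing T S'"
  by (cases S; cases S'; cases T) (simp add: algebra_simps)
lemma pairing_scale: "pairing (c *\<^sub>R S) T = c * pairing S T"
  by (cases S; cases T) (simp add: algebra_simps)
lemma pairing_commute: "pairing S T = pairing T S"
  by (cases S; cases T) (simp add: algebra_simps)
lemma pairing_add': "pairing T (S + S') = pairing T S + pairing T S'"
  by (metis pairing_add pairing_commute)
lemma pairing_scale': "pairing T (c *\<^sub>R S) = c * pairing T S"
  by (metis pairing_scale pairing_commute)
lemma act_add: "act N M (S + S') = act N M S + act N M S'"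
  by (cases S; cases S'; cases M) (simp add: algebra_simps add_divide_distrib diff_divide_distrib)
lemma act_scale: "act N M (c *\<^sub>R S) = c *\<^sub>R act N M S"
  by (cases S; cases M) (simp add: algebra_simps add_divide_distrib diff_divide_distrib)

text \<open>
The pairing has signature \<open>(1, 2)\<close>: this is the reversed Cauchy-Schwarz inequality with its equality
case.
\<close>

lemma orthogonal_to_definite:
  assumes "pairing V S = 0" "pairing S S > 0"
  shows "pairing V V \<le> 0" "pairing V V = 0 \<Longrightarrow> V = 0"
proof -
  obtain x y z where V: "V = (x, y, z)" by (metis surj_pair)
  obtain p q r where S: "S = (p, q, r)" by (metis surj_pair)
  have d: "p * r - q^2 > 0" using assms(2) by (simp add: S power2_eq_square algebra_simps)
  have p: "p \<noteq> 0" using d by auto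
  have z: "p * z = 2 * q * y - r * x" using assms(1) by (simp add: V S algebra_simps)
  have "p^2 * (x * z - y^2) = p * x * (p * z) - p^2 * y^2" by (simp add: algebra_simps power2_eq_square)
  also have "\<dots> = - ((p * y - q * x)^2 + (p * r - q^2) * x^2)"
    unfolding z by (simp add: algebra_simps power2_eq_square)
  finally have k: "p^2 * (x * z - y^2) = - ((p * y - q * x)^2 + (p * r - q^2) * x^2)" .
  have n: "(p * y - q * x)^2 \<ge> 0" "(p * r - q^2) * x^2 \<ge> 0" using d by auto
  have "p^2 * (x * z - y^2) \<le> 0" using k n by linarith
  then have "x * z - y^2 \<le> 0" using p by (simp add: mult_le_0_iff)
  then show "pairing V V \<le> 0" by (simp add: V power2_eq_square)
  assume "pairing V V = 0"
  then have "x * z - y^2 = 0" by (simp add: V power2_eq_square)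
  then have "(p * y - q * x)^2 + (p * r - q^2) * x^2 = 0" using k by simp
  then have e: "(p * y - q * x)^2 = 0" "(p * r - q^2) * x^2 = 0" using n by linarith+
  then have "x = 0" using d by auto
  with e p have "y = 0" by auto
  with \<open>x = 0\<close> z p show "V = 0" by (simp add: V zero_prod_def)
qed

text \<open>
Reflecting the image of \<open>S'\<close> in a side negates one coordinate of the image, and this changes its
pairing with \<open>S\<close> by four times the product of the two coordinates. Hence the pairing drops whenever
the image lies beyond a side on which \<open>S\<close> does not lie.
\<close>

lemma pairing_refl:
  assumes "N \<noteq> 0" "S = (p, q, r)" "act N M S' = (p', q', r')"
  shows "pairing S (act N (refl1 M) S') = pairing S (act N M S') + 4 * (p - q) * (p' - q')"
        "pairing S (act N (refl2 M) S') = pairing S (act N M S') + 4 * (r - q) * (r' - q')"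
        "pairing S (act N (refl3 M) S') = pairing S (act N M S') + 4 * q * q'"
        "act N (refl1 M) S' = (p', 2 * p' - q', r' + 4 * p' - 4 * q')"
        "act N (refl2 M) S' = (p' + 4 * r' - 4 * q', 2 * r' - q', r')"
        "act N (refl3 M) S' = (p', - q', r')"
proof -
  obtain u y a v where M: "M = (u, y, a, v)" by (metis surj_pair)
  obtain P Q R where S': "S' = (P, Q, R)" by (metis surj_pair)
  have e: "p' = (u^2 * P - 2 * u * y * Q + y^2 * R) / N"
     "q' = ((u * v + y * a) * Q - u * a * P - y * v * R) / N"
     "r' = (a^2 * P - 2 * a * v * Q + v^2 * R) / N"
    using assms(3) unfolding M S' by auto
  show 1: "act N (refl1 M) S' = (p', 2 * p' - q', r' + 4 * p' - 4 * q')"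
       and 2: "act N (refl2 M) S' = (p' + 4 * r' - 4 * q', 2 * r' - q', r')"
       and 3: "act N (refl3 M) S' = (p', - q', r')"
    unfolding M S' e refl1.simps refl2.simps refl3.simps act.simps prod.inject
    by (intro conjI; simp add: assms(1) field_simps power2_eq_square)+
  show "pairing S (act N (refl1 M) S') = pairing S (act N M S') + 4 * (p - q) * (p' - q')"
       "pairing S (act N (refl2 M) S') = pairing S (act N M S') + 4 * (r - q) * (r' - q')"
       "pairing S (act N (refl3 M) S') = pairing S (act N M S') + 4 * q * q'"
    unfolding 1 2 3 assms(2,3) by (simp_all add: algebra_simps)
qed

text \<open>
In the coordinates of \<open>S\<close> the left-hand side is a quadratic form whose coefficients are sums of
squares of determinants \<open>\<xi>\<^sub>i \<and> M \<xi>\<^sub>j\<close>. The diagonal ones are odd, because \<open>M\<close> fixes no cusp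
modulo \<open>2\<close>. So a point that \<open>M\<close> moves by a bounded amount stays away from the cusps.
\<close>

lemma pairing_act_ge:
  assumes "rotating (u, y, a, v)" "in_triangle (p, q, r)" "N > 0"
  shows "N * pairing (p, q, r) (act N (u, y, a, v) (p, q, r)) \<ge> (p - q)^2 + (r - q)^2 + q^2"
proof -
  define A1 A2 A3 where A: "A1 = p - q" "A2 = r - q" "A3 = q"
  have nn: "A1 \<ge> 0" "A2 \<ge> 0" "A3 \<ge> 0" using assms(2) A by auto
  have o: "odd (a - y + u - v)" "odd a" "odd y" using assms(1) by auto
  have sq: "(real_of_int m)^2 \<ge> 1" if "odd m" for m :: int
  proof -
    have "real_of_int (m^2) \<ge> 1" using one_le_odd_power2[OF that] by linarith
    then show ?thesis by simp
  qed
  have "N * pairing (p, q, r) (act N (u, y, a, v) (p, q, r)) =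
     A1^2 * (real_of_int a)^2 + A2^2 * (real_of_int y)^2 + A3^2 * (real_of_int (a - y + u - v))^2
     + A1 * A2 * ((real_of_int u)^2 + (real_of_int v)^2)
     + A1 * A3 * ((real_of_int (u + a))^2 + (real_of_int (a - v))^2)
     + A2 * A3 * ((real_of_int (v + y))^2 + (real_of_int (u - y))^2)"
    using assms(3) unfolding A by (simp add: divide_simps) (simp add: power2_eq_square algebra_simps)
  moreover have "A1^2 * (real_of_int a)^2 \<ge> A1^2 * 1" "A2^2 * (real_of_int y)^2 \<ge> A2^2 * 1"
     "A3^2 * (real_of_int (a - y + u - v))^2 \<ge> A3^2 * 1"
    by (rule mult_left_mono[OF sq zero_le_power2]; fact o)+
  moreover have "A1 * A2 * ((real_of_int u)^2 + (real_of_int v)^2) \<ge> 0"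
     "A1 * A3 * ((real_of_int (u + a))^2 + (real_of_int (a - v))^2) \<ge> 0"
     "A2 * A3 * ((real_of_int (v + y))^2 + (real_of_int (u - y))^2) \<ge> 0"
    using nn by auto
  ultimately show ?thesis unfolding A by linarith
qed

text \<open>
The smallest eigenvalue of a definite matrix of determinant \<open>1\<close> is at least the inverse of its trace.
\<close>

lemma definite_lower_bound:
  fixes p q r :: real
  assumes "p * r - q^2 = 1"
  shows "(p + r) * (r * x^2 + 2 * q * x * y + p * y^2) \<ge> x^2 + y^2"
proof -
  have "(p + r) * (r * x^2 + 2 * q * x * y + p * y^2) - (p * r - q^2) * (x^2 + y^2) = (p*y + q*x)^2 + (q*y + r*x)^2"
    by (simp add: algebra_simps power2_eq_square)
  then show ?thesis using assms by (smt (verit) zero_le_power2 mult_cancel_right1)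
qed

text \<open>
Only finitely many integer matrices move some point of a bounded region by a bounded amount.
\<close>

lemma pairing_act_entry_bound:
  assumes d: "p * r - q^2 = 1" and t: "in_triangle (p, q, r)" "N > 0"
  shows "(p + r)^2 * (N * pairing (p, q, r) (act N (u, y, a, v) (p, q, r)))
           \<ge> (real_of_int u)^2 + (real_of_int y)^2 + (real_of_int a)^2 + (real_of_int v)^2"
proof -
  have pr: "p \<ge> 0" "r \<ge> 0" "q \<ge> 0" using t by auto
  have "p * r > 0" using d by (smt (verit) zero_le_power2)
  then have pp: "p > 0" "r > 0" using pr by (auto simp: zero_less_mult_iff)
  define F where "F = (\<lambda>x y :: real. r * x^2 + 2 * q * x * y + p * y^2)"
  define G where "G = (\<lambda>x y :: real. p * x^2 - 2 * q * x * y + r * y^2)"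
  have F: "(p + r) * F x y \<ge> x^2 + y^2" for x y
    unfolding F_def by (rule definite_lower_bound[OF d])
  define U Y A V where e: "U = real_of_int u" "Y = real_of_int y" "A = real_of_int a" "V = real_of_int v"
  have G: "(p + r) * G x y \<ge> x^2 + y^2" for x y
    using definite_lower_bound[of r p "-q" x y] d unfolding G_def by (simp add: algebra_simps)
  \<comment> \<open>The pairing is the trace of a product of two definite matrices.\<close>
  have trace: "N * pairing (p, q, r) (act N (u, y, a, v) (p, q, r)) =
     r * G U Y + p * G A V - 2 * q * (- (U * A * p) + (U * V + Y * A) * q - Y * V * r)"
    using t unfolding e G_def by (simp add: divide_simps) (simp add: power2_eq_square algebra_simps)
  define Z where "Z = r * G U Y + p * G A V - 2 * q * (- (U * A * p) + (U * V + Y * A) * q - Y * V * r)"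
  have "p * Z = F (p * U - q * Y) (p * A - q * V) + (p * r - q^2) * F Y V"
    unfolding F_def G_def Z_def by (simp add: algebra_simps power2_eq_square)
  then have expand: "p * Z = F (p * U - q * Y) (p * A - q * V) + F Y V" using d by simp
  have "p * ((p + r)^2 * Z) = (p + r) * ((p + r) * (p * Z))"
    by (simp add: power2_eq_square)
  also have "\<dots> = (p + r) * ((p + r) * F (p * U - q * Y) (p * A - q * V) + (p + r) * F Y V)"
    unfolding expand by (simp add: distrib_left)
  also have "\<dots> \<ge> (p + r) * ((p * U - q * Y)^2 + (p * A - q * V)^2 + (Y^2 + V^2))"
    using F[of "p * U - q * Y" "p * A - q * V"] F[of Y V] pp by (intro mult_left_mono) auto
  also have "(p + r) * ((p * U - q * Y)^2 + (p * A - q * V)^2 + (Y^2 + V^2)) = (p + r) * p * (G U Y + G A V)"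
  proof -
    have sq: "(p * x - q * z)^2 + z^2 = p * G x z" for x z
    proof -
      have "(p * x - q * z)^2 + (p * r - q^2) * z^2 = p * G x z"
        unfolding G_def by (simp add: algebra_simps power2_eq_square)
      then show ?thesis using d by simp
    qed
    have "(p + r) * ((p * U - q * Y)^2 + (p * A - q * V)^2 + (Y^2 + V^2)) =
      (p + r) * (((p * U - q * Y)^2 + Y^2) + ((p * A - q * V)^2 + V^2))" by simp
    also have "\<dots> = (p + r) * (p * G U Y + p * G A V)" unfolding sq ..
    finally show ?thesis by (simp only: distrib_left mult.assoc)
  qed
  also have "(p + r) * p * (G U Y + G A V) \<ge> p * ((U^2 + Y^2) + (A^2 + V^2))"
  proof -
    have "p * ((p + r) * G U Y + (p + r) * G A V) \<ge> p * ((U^2 + Y^2) + (A^2 + V^2))"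
      using G[of U Y] G[of A V] pp by (intro mult_left_mono) auto
    then show ?thesis by (simp add: algebra_simps)
  qed
  finally have "(p + r)^2 * Z \<ge> (U^2 + Y^2) + (A^2 + V^2)"
    using pp by (simp only: mult_le_cancel_left_pos)
  then show ?thesis unfolding trace Z_def e by (simp only: add.assoc)
qed

section \<open>A fixed point in the ideal triangle\<close>

text \<open>
The set \<open>C\<close> plays the role of the coset of an integer matrix under the reflection group of the ideal
triangle. Folding the plane onto the triangle \<open>T\<close> turns the coset into one continuous map
\<open>f : T \<rightarrow> T\<close> that does not increase distances and permutes the cusps, and the goal is a fixed
point of \<open>f\<close>. It is found as a point \<open>S\<close> of least displacement. If \<open>f S \<noteq> S\<close>, then the midpoint of
\<open>S\<close> and \<open>f S\<close> is moved at most as far, so equality holds throughout and \<open>S\<close>, \<open>f S\<close>, \<open>f (f S)\<close>, ...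
march along a geodesic; as the minimal displacement keeps them away from the cusps, a geodesic ray
would stay in a bounded part of the triangle, which is impossible.
\<close>

locale reflection_closed =
  fixes C :: "imat set" and N :: real
  assumes N_pos: "N > 0"
    and nonempty: "C \<noteq> {}"
    and det: "\<And>M. M \<in> C \<Longrightarrow> (of_int (idet M))^2 = N^2"
    and rot: "\<And>M. M \<in> C \<Longrightarrow> rotating M"
    and closed: "\<And>M. M \<in> C \<Longrightarrow> refl1 M \<in> C" "\<And>M. M \<in> C \<Longrightarrow> refl2 M \<in> C" "\<And>M. M \<in> C \<Longrightarrow> refl3 M \<in> C"
begin

definition lower :: "real \<Rightarrow> bool" where
  "lower h \<longleftrightarrow> (\<forall>M\<in>C. \<forall>S. in_triangle S \<longrightarrow> h * pairing S S \<le> 2 * pairing S (act N M S))"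

definition minimizer :: "real \<Rightarrow> imat \<Rightarrow> form \<Rightarrow> bool" where
  "minimizer h M S \<longleftrightarrow> lower h \<and> M \<in> C \<and> in_triangle S \<and> pairing S S = 2 \<and> pairing S (act N M S) = h"

lemma coordinate_bound:
  assumes "M \<in> C" "in_triangle (p, q, r)" "N * pairing (p, q, r) (act N M (p, q, r)) \<le> v"
  shows "q \<le> v + 1" "p \<le> 2 * (v + 1)" "r \<le> 2 * (v + 1)" "0 \<le> v"
proof -
  obtain u y a w where M: "M = (u, y, a, w)" by (metis surj_pair)
  have s: "(p - q)^2 + (r - q)^2 + q^2 \<le> v"
    using pairing_act_ge[of u y a w p q r N] assms rot[OF assms(1)] N_pos M by auto
  have z: "(p - q)^2 \<ge> 0" "(r - q)^2 \<ge> 0" "q^2 \<ge> 0" by auto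
  show v: "0 \<le> v" using s z by linarith
  have le: "x \<le> v + 1" if "x^2 \<le> v" for x :: real
  proof -
    have "(v + 1)^2 \<ge> v" using v by (simp add: power2_eq_square algebra_simps)
    then show ?thesis using that v by (smt (verit) power2_le_imp_le)
  qed
  have l: "p - q \<le> v + 1" "r - q \<le> v + 1" "q \<le> v + 1"
    by (rule le; use s z in linarith)+
  show "q \<le> v + 1" by (fact l(3))
  show "p \<le> 2 * (v + 1)" using l(1,3) by (simp add: algebra_simps)
  show "r \<le> 2 * (v + 1)" using l(2,3) by (simp add: algebra_simps)
qed

text \<open>
A minimum over a noncompact triangle and infinitely many matrices exists, because a displacement not
larger than a given one confines the point to a compact set and the matrix to a finite set.
\<close>

lemma minimizer_exists: "\<exists>h M S. minimizer h M S"
proof -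
  obtain M0 where M0: "M0 \<in> C" using nonempty by auto
  define val where "val = (\<lambda>M S. pairing S (act N M S))"
  define v0 where "v0 = val M0 (1, 0, 1)"
  define B where "B = 2 * (N * v0 + 1)"
  have v0: "0 \<le> N * v0" using coordinate_bound(4)[OF M0, of 1 0 1 "N * v0"] by (simp add: v0_def val_def)
  define K where "K = ({0..B} \<times> {0..B} \<times> {0..B}) \<inter>
     {S :: form. fst (snd S) \<le> fst S \<and> fst (snd S) \<le> snd (snd S) \<and>
        2 * fst S * snd (snd S) - 2 * fst (snd S) * fst (snd S) = 2}"
  have "compact K" unfolding K_def
    by (intro compact_Int_closed compact_Times compact_Icc closed_Collect_conj closed_Collect_le
          closed_Collect_eq continuous_intros)
  have Kiff: "S \<in> K \<longleftrightarrow> in_triangle S \<and> pairing S S = 2 \<and> fst S \<le> B \<and> snd (snd S) \<le> B" for S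
    unfolding K_def by (cases S) (auto simp: algebra_simps)
  have K1: "(1, 0, 1) \<in> K" using v0 by (auto simp: Kiff B_def)
  define E where "E = \<lceil>(2 * B)^2 * (N * v0)\<rceil>"
  define F where "F = C \<inter> ({-E..E} \<times> {-E..E} \<times> {-E..E} \<times> {-E..E})"
  have "finite F" unfolding F_def by auto
  have inK: "S \<in> K \<and> M \<in> F" if S: "in_triangle S" "pairing S S = 2" and M: "M \<in> C" and v: "val M S \<le> v0" for M S
  proof -
    obtain p q r where Sd: "S = (p, q, r)" by (metis surj_pair)
    obtain u y a w where Md: "M = (u, y, a, w)" by (metis surj_pair)
    have nv: "N * pairing (p, q, r) (act N M (p, q, r)) \<le> N * v0"
      using v less_imp_le[OF N_pos] unfolding Sd val_def by (rule mult_left_mono)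
    have b: "p \<le> B" "r \<le> B" using coordinate_bound[OF M _ nv] S unfolding Sd B_def by auto
    then have K: "S \<in> K" using S by (simp add: Kiff Sd)
    have d: "p * r - q^2 = 1" using S unfolding Sd by (simp add: power2_eq_square algebra_simps)
    have "(real_of_int u)^2 + (real_of_int y)^2 + (real_of_int a)^2 + (real_of_int w)^2
       \<le> (p + r)^2 * (N * pairing (p, q, r) (act N M (p, q, r)))"
      using pairing_act_entry_bound[OF d _ N_pos, of u y a w] S Md Sd by simp
    also have "\<dots> \<le> (p + r)^2 * (N * v0)" by (rule mult_left_mono[OF nv]) simp
    also have "\<dots> \<le> (2 * B)^2 * (N * v0)" using b v0 S unfolding Sd
      by (intro mult_right_mono power_mono) auto
    also have "\<dots> \<le> E" unfolding E_def by linarith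
    finally have "real_of_int (u^2 + y^2 + a^2 + w^2) \<le> E" by simp
    then have e: "u^2 + y^2 + a^2 + w^2 \<le> E" by linarith
    have z: "u^2 \<ge> 0" "y^2 \<ge> 0" "a^2 \<ge> 0" "w^2 \<ge> 0" by auto
    have "M \<in> F" using abs_le_power2_int[of u] abs_le_power2_int[of y] abs_le_power2_int[of a]
        abs_le_power2_int[of w] e z M unfolding F_def Md by auto
    then show ?thesis using K by simp
  qed
  have cont: "continuous_on K (val M)" for M
  proof -
    obtain u y a w where Md: "M = (u, y, a, w)" by (metis surj_pair)
    have "val M = (\<lambda>S :: form. let p = fst S; q = fst (snd S); r = snd (snd S) in
       p * ((a^2 * p - 2 * a * w * q + w^2 * r) / N) + r * ((u^2 * p - 2 * u * y * q + y^2 * r) / N)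
       - 2 * q * (((u * w + y * a) * q - u * a * p - y * w * r) / N))"
      by (rule ext) (auto simp: val_def Md Let_def)
    then show ?thesis using N_pos by (simp add: Let_def) (intro continuous_intros; simp)
  qed
  have "\<exists>S\<in>K. \<forall>S'\<in>K. val M S \<le> val M S'" for M
    using continuous_attains_inf[OF \<open>compact K\<close> _ cont] K1 by blast
  then obtain best where best: "best M \<in> K" "\<And>S'. S' \<in> K \<Longrightarrow> val M (best M) \<le> val M S'" for M
    by metis
  have M0F: "M0 \<in> F" using inK[of "(1, 0, 1)" M0] M0 K1 by (simp add: Kiff v0_def)
  then obtain M where M: "M \<in> F" "\<And>M'. M' \<in> F \<Longrightarrow> val M (best M) \<le> val M' (best M')"
    using ex_is_arg_min_if_finite[OF \<open>finite F\<close>, of "\<lambda>M. val M (best M)"]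
    unfolding is_arg_min_linorder by blast
  define h where "h = val M (best M)"
  have hv0: "h \<le> v0"
    using M(2)[OF M0F] best(2)[OF K1, of M0] unfolding h_def v0_def by linarith
  have norm: "h \<le> val M' S" if "M' \<in> C" "in_triangle S" "pairing S S = 2" for M' S
  proof (cases "val M' S \<le> v0")
    case True
    then have "S \<in> K" "M' \<in> F" using inK that by auto
    then show ?thesis using M(2)[of M'] best(2)[of S M'] unfolding h_def by linarith
  qed (use hv0 in linarith)
  have "lower h" unfolding lower_def
  proof (intro ballI allI impI)
    fix M' S assume M': "M' \<in> C" and S: "in_triangle S"
    obtain p q r where Sd: "S = (p, q, r)" by (metis surj_pair)
    have "q * q \<le> p * r" using S unfolding Sd by (auto intro: mult_mono)
    then have d0: "pairing S S \<ge> 0" by (simp add: Sd)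
    show "h * pairing S S \<le> 2 * pairing S (act N M' S)"
    proof (cases "pairing S S = 0")
      case True
      have "N * pairing S (act N M' S) \<ge> 0"
        using coordinate_bound(4)[OF M', of p q r] S unfolding Sd by blast
      then show ?thesis using True N_pos by (simp add: zero_le_mult_iff)
    next
      case False
      define c where "c = 1 / sqrt (pairing S S / 2)"
      have c: "c > 0" "c^2 * pairing S S = 2" using False d0
        by (auto simp: c_def power_divide)
      have "in_triangle (c *\<^sub>R S)" using c S unfolding Sd by auto
      moreover have "pairing (c *\<^sub>R S) (c *\<^sub>R S) = 2"
        using c by (simp add: pairing_scale pairing_scale' power2_eq_square algebra_simps)
      ultimately have "h \<le> val M' (c *\<^sub>R S)" using norm M' by blast
      also have "\<dots> = c^2 * pairing S (act N M' S)"
        unfolding val_def by (simp add: pairing_scale pairing_scale' act_scale power2_eq_square)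
      finally have "h * pairing S S \<le> c^2 * pairing S (act N M' S) * pairing S S"
        using d0 by (rule mult_right_mono)
      also have "\<dots> = 2 * pairing S (act N M' S)" using c(2) by (metis mult.assoc mult.commute)
      finally show ?thesis .
    qed
  qed
  moreover have "M \<in> C" "in_triangle (best M)" "pairing (best M) (best M) = 2"
    using M(1) best(1)[of M] unfolding F_def by (auto simp: Kiff)
  ultimately show ?thesis unfolding minimizer_def h_def val_def by blast
qed

text \<open>
Testing minimality at \<open>S + M S\<close>, which represents the midpoint, gives the inequality opposite to the
triangle inequality for \<open>S\<close>, \<open>M S\<close>, \<open>M (M S)\<close>. Hence these three lie on one geodesic.
\<close>

lemma second_image:
  assumes "minimizer h M S" "in_triangle (act N M S)"
  shows "act N M (act N M S) = h *\<^sub>R act N M S - S"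
proof -
  define S1 S2 where s: "S1 = act N M S" "S2 = act N M S1"
  have C: "M \<in> C" "lower h" "in_triangle S" "pairing S S = 2" "pairing S S1 = h"
    using assms unfolding minimizer_def s by auto
  have iso: "pairing (act N M X) (act N M Y) = pairing X Y" for X Y
    using pairing_act det[OF C(1)] N_pos by auto
  have p: "pairing S1 S1 = 2" "pairing S1 S2 = h" "pairing S2 S2 = 2"
    using C(4,5) iso unfolding s by auto
  have "in_triangle (S + S1)" using assms(2) C(3) unfolding s(1)[symmetric] by (cases S; cases S1) auto
  then have "h * pairing (S + S1) (S + S1) \<le> 2 * pairing (S + S1) (act N M (S + S1))"
    using C(1,2) unfolding lower_def by blast
  also have "act N M (S + S1) = S1 + S2" by (simp add: act_add s)
  finally have "h * (4 + 2 * h) \<le> 2 * (2 * h + 2 + pairing S S2)"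
    using C p pairing_commute[of S1 S] by (simp add: pairing_add pairing_add' algebra_simps)
  then have e: "pairing S S2 \<ge> h^2 - 2" by (simp add: algebra_simps power2_eq_square)
  \<comment> \<open>\<open>V\<close> vanishes exactly if the three points are equally spaced on a geodesic; it is orthogonal to \<open>S1\<close>.\<close>
  define V where "V = S + S2 - h *\<^sub>R S1"
  have o: "pairing V S1 = 0"
    using C p pairing_commute[of S2 S1] by (simp add: V_def pairing_add pairing_diff pairing_scale)
  have "pairing V V = 4 + 2 * pairing S S2 - 2 * h^2"
    using C p pairing_commute[of S2 S1] pairing_commute[of S2 S] pairing_commute[of S1 S]
    by (simp add: V_def pairing_add pairing_diff pairing_scale pairing_add' pairing_diff' pairing_scale' power2_eq_square algebra_simps)
  then have "pairing V V = 0" using e orthogonal_to_definite(1)[OF o] p by simp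
  then have "V = 0" using orthogonal_to_definite(2)[OF o] p by simp
  then show ?thesis unfolding V_def s[symmetric] by (simp add: algebra_simps eq_neg_iff_add_eq_0)
qed

lemma displacement_gt:
  assumes "pairing S S = 2" "pairing S1 S1 = 2" "pairing S S1 = h" "h \<ge> 0" "S1 \<noteq> S"
  shows "h > 2"
proof -
  define W where "W = S1 - (h / 2) *\<^sub>R S"
  have o: "pairing W S = 0" using assms pairing_commute[of S1 S] by (simp add: W_def pairing_diff pairing_scale)
  have ww: "pairing W W = 2 - h^2 / 2" using assms pairing_commute[of S1 S]
    by (simp add: W_def pairing_add pairing_diff pairing_scale pairing_add' pairing_diff' pairing_scale' power2_eq_square algebra_simps)
  have "pairing W W \<le> 0" using orthogonal_to_definite(1)[OF o] assms by simp
  then have "2^2 \<le> h^2" using ww by simp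
  then have "h \<ge> 2" using assms(4) by (rule power2_le_imp_le)
  moreover have "h \<noteq> 2"
  proof
    assume "h = 2"
    then have "pairing W W = 0" using ww by simp
    then have "W = 0" using orthogonal_to_definite(2)[OF o] assms by simp
    then have "S1 = S" using \<open>h = 2\<close> by (simp add: W_def)
    then show False using assms by simp
  qed
  ultimately show ?thesis by simp
qed

text \<open>
Otherwise the reflected matrix would move the point less.
\<close>

lemma minimizer_image_sides:
  assumes "minimizer h M (p, q, r)" "act N M (p, q, r) = (p', q', r')"
  shows "p > q \<Longrightarrow> p' \<ge> q'" "r > q \<Longrightarrow> r' \<ge> q'" "q > 0 \<Longrightarrow> q' \<ge> 0"
proof -
  have m: "lower h" "M \<in> C" "in_triangle (p, q, r)" "pairing (p, q, r) (p, q, r) = 2"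
     "pairing (p, q, r) (act N M (p, q, r)) = h"
    using assms unfolding minimizer_def by auto
  have l: "h \<le> pairing (p, q, r) (act N M' (p, q, r))" if "M' \<in> C" for M'
  proof -
    have "h * pairing (p, q, r) (p, q, r) \<le> 2 * pairing (p, q, r) (act N M' (p, q, r))"
      using m(1,3) that unfolding lower_def by blast
    then show ?thesis using m(4) by simp
  qed
  note rr = pairing_refl[OF _ refl assms(2)]
  have N0: "N \<noteq> 0" using N_pos by simp
  show "p > q \<Longrightarrow> p' \<ge> q'"
    using l[OF closed(1)[OF m(2)]] unfolding rr(1)[OF N0, of p q r] m(5) by (simp add: zero_le_mult_iff)
  show "r > q \<Longrightarrow> r' \<ge> q'"
    using l[OF closed(2)[OF m(2)]] unfolding rr(2)[OF N0, of p q r] m(5) by (simp add: zero_le_mult_iff)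
  show "q > 0 \<Longrightarrow> q' \<ge> 0"
    using l[OF closed(3)[OF m(2)]] unfolding rr(3)[OF N0, of p q r] m(5) by (simp add: zero_le_mult_iff)
qed


text \<open>
On a side of the triangle, the points of determinant \<open>1\<close> form a hyperbola \<open>x y = 1\<close>. A linear form that
vanishes at two distinct points of it is zero.
\<close>

lemma edge_dependence:
  fixes x y x' y' X Y :: real
  assumes "x * y = 1" "x' * y' = 1" "x > 0" "x' > 0" "x * X + y * Y = 0" "x' * X + y' * Y = 0"
     "x \<noteq> x'"
  shows "X = 0 \<and> Y = 0"
proof -
  have e: "x^2 * X + Y = 0" "x'^2 * X + Y = 0"
  proof -
    have "x^2 * X + Y = x * (x * X + y * Y)" using assms(1) by (simp add: algebra_simps power2_eq_square)
    then show "x^2 * X + Y = 0" using assms by simp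
    have "x'^2 * X + Y = x' * (x' * X + y' * Y)" using assms(2) by (simp add: algebra_simps power2_eq_square)
    then show "x'^2 * X + Y = 0" using assms by simp
  qed
  have "x^2 \<noteq> x'^2" using assms(3,4,7) by (simp add: power2_eq_iff_nonneg)
  moreover have "(x^2 - x'^2) * X = 0" using e unfolding left_diff_distrib by linarith
  ultimately have "X = 0" by simp
  then show ?thesis using e by simp
qed

text \<open>
Suppose that the image \<open>M S\<close> lies on a side. Then \<open>M\<close> and its reflection both satisfy the geodesic
relation with the same second image, which forces \<open>S\<close> and \<open>M (M S)\<close> onto that side as well. So \<open>M\<close>
preserves the line carrying the side, which the parities of its entries exclude.
\<close>

lemma interior_image:
  assumes m: "minimizer h M S" and t: "in_triangle (act N M S)" and ne: "act N M S \<noteq> S"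
    and S1: "act N M S = (p', q', r')"
  shows "q' > 0 \<and> p' > q' \<and> r' > q'"
proof -
  obtain p q r where S: "S = (p, q, r)" by (metis surj_pair)
  obtain u y a v where M: "M = (u, y, a, v)" by (metis surj_pair)
  have N0: "N \<noteq> 0" using N_pos by simp
  have mC: "M \<in> C" and d: "pairing S S = 2" and tS: "in_triangle S" and low: "lower h"
    and ph: "pairing S (act N M S) = h"
    using m unfolding minimizer_def by auto
  have o: "odd a" "odd y" "odd (u + v)" using rot[OF mC] M by auto
  have d1: "pairing (p', q', r') (p', q', r') = 2"
    using pairing_act[OF det[OF mC] N0, of S S] d S1 by simp
  note S2 = second_image[OF m t]
  obtain x z w where X: "act N M (p', q', r') = (x, z, w)" by (metis surj_pair)
  have X': "x = h * p' - p" "z = h * q' - q" "w = h * r' - r"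
    using S2[unfolded S1, unfolded X] unfolding S by auto
  \<comment> \<open>If the image lies on an edge, the reflected matrix is a minimiser with the same image.\<close>
  have same: "act N M' (p', q', r') = (x, z, w)" if M': "M' \<in> C" "act N M' S = (p', q', r')" for M'
  proof -
    have "minimizer h M' S" using M' d tS low ph S1 unfolding minimizer_def by simp
    from second_image[OF this] t M' S1 S2 X show ?thesis by simp
  qed
  note rr = pairing_refl(4-6)[OF N0]
  have eqs: "N * p' = u^2 * p - 2 * u * y * q + y^2 * r"
     "N * q' = (u * v + y * a) * q - u * a * p - y * v * r"
     "N * r' = a^2 * p - 2 * a * v * q + v^2 * r"
     "N * x = u^2 * p' - 2 * u * y * q' + y^2 * r'"
     "N * z = (u * v + y * a) * q' - u * a * p' - y * v * r'"
     "N * w = a^2 * p' - 2 * a * v * q' + v^2 * r'"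
    using S1 X N0 unfolding S M by auto
  have t': "0 \<le> q" "q \<le> p" "q \<le> r" "0 \<le> q'" "q' \<le> p'" "q' \<le> r'"
    using tS t[unfolded S1] unfolding S by auto
  have dd: "p * r - q * q = 1" "p' * r' - q' * q' = 1" using d d1 unfolding S by auto
  have "q' \<noteq> 0"
  proof
    assume q': "q' = 0"
    have "act N (refl3 M) S = (p', q', r')" using rr(3)[OF S S1] q' by simp
    from same[OF closed(3)[OF mC] this] rr(3)[OF refl X] have "z = 0" by simp
    then have q: "q = 0" using X' q' by simp
    have "p > 0" "p' > 0" using dd q q' t' by (auto simp: less_le)
    moreover have "p \<noteq> p'"
    proof
      assume "p = p'"
      then have "p * r = p * r'" using dd q q' by simp
      then show False using \<open>p > 0\<close> \<open>p = p'\<close> ne S1 S q q' by simp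
    qed
    ultimately have "real_of_int (u * a) = 0 \<and> real_of_int (y * v) = 0"
      using dd q q' eqs(2,5) \<open>z = 0\<close> by (intro edge_dependence[of p r p' r']) (auto simp: algebra_simps)
    then show False using o by auto
  qed
  moreover have "p' \<noteq> q'"
  proof
    assume q': "p' = q'"
    have "act N (refl1 M) S = (p', q', r')" using rr(1)[OF S S1] q' by simp
    from same[OF closed(1)[OF mC] this] rr(1)[OF refl X] have xz: "x = z" by simp
    then have q: "p = q" using X' q' by simp
    have "p > 0" "p' > 0" using dd q q' t' by (auto simp: less_le)
    moreover have "p \<noteq> p'"
    proof
      assume "p = p'"
      have "p * r = 1 + p * p" "p' * r' = 1 + p' * p'" using dd q q' by auto
      then have "p * r = p * r'" unfolding \<open>p = p'\<close> by linarith
      then show False using \<open>p > 0\<close> \<open>p = p'\<close> ne S1 S q q' by simp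
    qed
    moreover have "p * real_of_int ((u - y) * (u - y - v + a)) + (r - p) * real_of_int (y * (y + v)) = 0"
      "p' * real_of_int ((u - y) * (u - y - v + a)) + (r' - p') * real_of_int (y * (y + v)) = 0"
      using eqs(1,2,4,5) q q' xz by (auto simp: algebra_simps power2_eq_square)
    ultimately have "real_of_int ((u - y) * (u - y - v + a)) = 0 \<and> real_of_int (y * (y + v)) = 0"
      using dd q q' by (intro edge_dependence[of p "r - p" p' "r' - p'"]) (auto simp: algebra_simps)
    then have "(u - y) * (u - y - v + a) = 0" "y * (y + v) = 0" by (simp_all only: of_int_eq_0_iff)
    moreover have "u - y - v + a \<noteq> 0" "y \<noteq> 0" using o by presburger+
    ultimately have "u = y" "v = - y" by auto
    then show False using o by simp
  qed
  moreover have "r' \<noteq> q'"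
  proof
    assume q': "r' = q'"
    have "act N (refl2 M) S = (p', q', r')" using rr(2)[OF S S1] q' by simp
    from same[OF closed(2)[OF mC] this] rr(2)[OF refl X] have xz: "w = z" by simp
    then have q: "r = q" using X' q' by simp
    have "r > 0" "r' > 0" using dd q q' t' by (auto simp: less_le)
    moreover have "r \<noteq> r'"
    proof
      assume "r = r'"
      have "p * r = 1 + r * r" "p' * r' = 1 + r' * r'" using dd q q' by auto
      then have "p * r = p' * r" unfolding \<open>r = r'\<close> by linarith
      then show False using \<open>r > 0\<close> \<open>r = r'\<close> ne S1 S q q' by simp
    qed
    moreover have "r * real_of_int ((a - v) * (a - v + u - y)) + (p - r) * real_of_int (a * (a + u)) = 0"
      "r' * real_of_int ((a - v) * (a - v + u - y)) + (p' - r') * real_of_int (a * (a + u)) = 0"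
      using eqs(2,3,5,6) q q' xz by (auto simp: algebra_simps power2_eq_square)
    ultimately have "real_of_int ((a - v) * (a - v + u - y)) = 0 \<and> real_of_int (a * (a + u)) = 0"
      using dd q q' by (intro edge_dependence[of r "p - r" r' "p' - r'"]) (auto simp: algebra_simps)
    then have "(a - v) * (a - v + u - y) = 0" "a * (a + u) = 0" by (simp_all only: of_int_eq_0_iff)
    moreover have "a - v + u - y \<noteq> 0" "a \<noteq> 0" using o by presburger+
    ultimately have "a = v" "u = - a" by auto
    then show False using o by simp
  qed
  ultimately show ?thesis using t' by auto
qed

text \<open>
A coordinate of the image can be negative only if the same coordinate of \<open>S\<close> vanishes; reflecting the
matrix in that side repairs the sign without changing the displacement.
\<close>

lemma minimizer_into_triangle:
  obtains h M S where "minimizer h M S" "in_triangle (act N M S)"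
proof -
  obtain h M S where m: "minimizer h M S" using minimizer_exists by blast
  obtain p q r where S: "S = (p, q, r)" by (metis surj_pair)
  obtain p' q' r' where S1: "act N M S = (p', q', r')" by (metis surj_pair)
  have N0: "N \<noteq> 0" using N_pos by simp
  have mC: "M \<in> C" and d: "pairing S S = 2" and tS: "in_triangle S" and low: "lower h"
    and ph: "pairing S (act N M S) = h"
    using m unfolding minimizer_def by auto
  have t: "0 \<le> q" "q \<le> p" "q \<le> r" using tS unfolding S by auto
  have dd: "p * r - q * q = 1" using d unfolding S by auto
  note sides = minimizer_image_sides[OF m[unfolded S] S1[unfolded S]]
  have mini: "minimizer h M' S" if "M' \<in> C" "pairing S (act N M' S) = h" for M'
    using that d tS low unfolding minimizer_def by simp
  note rr = pairing_refl[OF N0 S S1]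
  have two: "\<not> (q = 0 \<and> p = q)" "\<not> (q = 0 \<and> r = q)" "\<not> (p = q \<and> r = q)" using dd by auto
  show thesis
  proof (cases "in_triangle (act N M S)")
    case True
    then show ?thesis using that m by blast
  next
    case False
    then consider "q' < 0" | "p' < q'" | "r' < q'" unfolding S1 by fastforce
    then show ?thesis
    proof cases
      case 1
      then have q: "q = 0" using sides(3) t by fastforce
      have m': "minimizer h (refl3 M) S" using mini[OF closed(3)[OF mC]] rr(3) ph q by simp
      note sides' = minimizer_image_sides[OF m'[unfolded S] rr(6)[unfolded S]]
      have "in_triangle (act N (refl3 M) S)" unfolding rr(6) using sides' 1 q two t by auto
      then show ?thesis using that m' by blast
    next
      case 2
      then have q: "p = q" using sides(1) t by fastforce
      have m': "minimizer h (refl1 M) S" using mini[OF closed(1)[OF mC]] rr(1) ph q by simp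
      note sides' = minimizer_image_sides[OF m'[unfolded S] rr(4)[unfolded S]]
      have "in_triangle (act N (refl1 M) S)" unfolding rr(4) using sides' 2 q two t by auto
      then show ?thesis using that m' by blast
    next
      case 3
      then have q: "r = q" using sides(2) t by fastforce
      have m': "minimizer h (refl2 M) S" using mini[OF closed(2)[OF mC]] rr(2) ph q by simp
      note sides' = minimizer_image_sides[OF m'[unfolded S] rr(5)[unfolded S]]
      have "in_triangle (act N (refl2 M) S)" unfolding rr(5) using sides' 3 q two t by auto
      then show ?thesis using that m' by blast
    qed
  qed
qed

text \<open>
The trace; on matrices of determinant \<open>1\<close> it tends to infinity towards the boundary of the plane.
\<close>

fun height :: "form \<Rightarrow> real" where "height (p, q, r) = p + r"

lemma height_diff: "height (c *\<^sub>R S - S') = c * height S - height S'"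
  by (cases S; cases S') (simp add: algebra_simps)

lemma height_bounds:
  assumes "minimizer h M S"
  shows "height S \<ge> 2" "height S \<le> 4 * (N * h + 1)"
proof -
  obtain p q r where S: "S = (p, q, r)" by (metis surj_pair)
  have "p * r - q * q = 1" "p \<ge> 0" "r \<ge> 0" using assms unfolding minimizer_def S by auto
  then have "p * r \<ge> 1" by (smt (verit) zero_le_square)
  have "(p + r)^2 = (p - r)^2 + 4 * (p * r)" by (simp add: power2_eq_square algebra_simps)
  then have "(p + r)^2 \<ge> 4" using \<open>p * r \<ge> 1\<close> zero_le_power2[of "p - r"] by linarith
  then have "(p + r)^2 \<ge> 2^2" by simp
  then show "height S \<ge> 2" using \<open>p \<ge> 0\<close> \<open>r \<ge> 0\<close> unfolding S height.simps
    by (intro power2_le_imp_le[of 2 "p + r"]) auto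
  have "M \<in> C" "in_triangle (p, q, r)" "N * pairing (p, q, r) (act N M (p, q, r)) \<le> N * h"
    using assms unfolding minimizer_def S by auto
  from coordinate_bound(2,3)[OF this] show "height S \<le> 4 * (N * h + 1)" unfolding S by simp
qed

text \<open>
If the minimiser were not fixed, its iterates would obey \<open>s (k + 2) = h s (k + 1) - s k\<close> with \<open>h > 2\<close>,
so their heights would be a strictly convex sequence with differences growing without bound. But all
iterates are minimisers, and the heights of minimisers are bounded.
\<close>

lemma fixed_minimizer:
  obtains M S where "M \<in> C" "in_triangle S" "pairing S S = 2" "act N M S = S"
proof -
  obtain h M S where m: "minimizer h M S" and t: "in_triangle (act N M S)"
    using minimizer_into_triangle by blast
  have N0: "N \<noteq> 0" using N_pos by simp
  have mC: "M \<in> C" and low: "lower h" using m unfolding minimizer_def by auto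
  have iso: "pairing (act N M X) (act N M Y) = pairing X Y" for X Y
    using pairing_act[OF det[OF mC] N0] .
  have "act N M S = S"
  proof (rule ccontr)
    assume ne: "act N M S \<noteq> S"
    define s where "s = (\<lambda>k. (act N M ^^ k) S)"
    have s0: "s 0 = S" and sS: "s (Suc k) = act N M (s k)" for k by (auto simp: s_def)
    have all: "minimizer h M (s k) \<and> in_triangle (s (Suc k)) \<and> s (Suc k) \<noteq> s k" for k
    proof (induction k)
      case 0
      then show ?case using m t ne by (simp add: s0 sS)
    next
      case (Suc k)
      obtain p q r where k1: "s (Suc k) = (p, q, r)" by (metis surj_pair)
      obtain p' q' r' where k2: "s (Suc (Suc k)) = (p', q', r')" by (metis surj_pair)
      have mk: "minimizer h M (s (Suc k))"
        using Suc iso unfolding minimizer_def sS by auto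
      have pos: "q > 0 \<and> p > q \<and> r > q"
        using interior_image[of h M "s k" p q r] Suc k1 unfolding sS by auto
      then have "in_triangle (s (Suc (Suc k)))"
        using minimizer_image_sides[OF mk[unfolded k1], of p' q' r'] k1 k2 unfolding sS[of "Suc k"] by auto
      moreover have "s (Suc (Suc k)) \<noteq> s (Suc k)"
      proof
        assume eq: "s (Suc (Suc k)) = s (Suc k)"
        have "s (Suc (Suc k)) = h *\<^sub>R s (Suc k) - s k"
          using second_image[of h M "s k"] Suc unfolding sS by auto
        then have sk: "s k = (h - 1) *\<^sub>R s (Suc k)" using eq by (simp add: algebra_simps)
        have "pairing (s k) (s k) = 2" "pairing (s (Suc k)) (s (Suc k)) = 2" "pairing (s k) (s (Suc k)) = h"
          using Suc mk unfolding minimizer_def sS by auto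
        then have "2 = (h - 1) * h" "h = (h - 1) * 2" unfolding sk
          by (simp_all add: pairing_scale pairing_scale')
        then have "h = 2" by simp
        then show False using sk Suc by simp
      qed
      ultimately show ?case using mk by blast
    qed
    have rec: "s (Suc (Suc k)) = h *\<^sub>R s (Suc k) - s k" for k
      using second_image[of h M "s k"] all[of k] unfolding sS by auto
    have "h \<ge> 0" using coordinate_bound(4)[OF mC, of "fst S" "fst (snd S)" "snd (snd S)" "N * h"] m N_pos
      unfolding minimizer_def by (auto simp: zero_le_mult_iff)
    then have h2: "h > 2"
      using displacement_gt[of S "act N M S" h] m ne iso unfolding minimizer_def by auto
    define f where "f = (\<lambda>k. height (s k))"
    have f: "f (Suc (Suc k)) = h * f (Suc k) - f k" "f k \<ge> 2" "f k \<le> 4 * (N * h + 1)" for k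
      using height_bounds[of h M "s k"] all[of k] unfolding f_def rec height_diff by auto
    define e where "e = 2 * (h - 2)"
    have e: "e > 0" using h2 by (simp add: e_def)
    have conv: "f (Suc (Suc k)) - f (Suc k) \<ge> f (Suc k) - f k + e" for k
    proof -
      have "(h - 2) * f (Suc k) \<ge> (h - 2) * 2" using f(2) h2 by (intro mult_left_mono) auto
      then show ?thesis unfolding f(1) e_def by (simp add: algebra_simps)
    qed
    have diff: "f (Suc k) - f k \<ge> f 1 - f 0 + k * e" for k
    proof (induction k)
      case (Suc k)
      then show ?case using conv[of k] by (simp add: algebra_simps)
    qed simp
    obtain k0 :: nat where k0: "k0 * e \<ge> f 0 - f 1 + 1"
      using reals_Archimedean3[OF e] by (metis less_imp_le)
    have step: "f (Suc (k0 + j)) - f (k0 + j) \<ge> 1" for j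
    proof -
      have "real (k0 + j) * e \<ge> k0 * e" using e by (intro mult_right_mono) auto
      then show ?thesis using diff[of "k0 + j"] k0 by linarith
    qed
    have "f (k0 + j) \<ge> f k0 + j" for j
    proof (induction j)
      case (Suc j)
      then show ?case using step[of j] by simp
    qed simp
    moreover obtain j :: nat where "real j > 4 * (N * h + 1)" using reals_Archimedean2 by blast
    ultimately have "f (k0 + j) > 4 * (N * h + 1)" using f(2)[of k0] by (smt (verit))
    then show False using f(3)[of "k0 + j"] by simp
  qed
  then show thesis using that[OF mC, of S] m unfolding minimizer_def by auto
qed

text \<open>
An orientation-reversing isometry with a fixed point has trace \<open>0\<close>, and the trace \<open>u + v\<close> is odd. So the
fixed point belongs to a matrix of determinant \<open>N\<close>. Its triangle coordinates are then proportional to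
\<open>2 c - b\<close>, \<open>2 a - b\<close> and \<open>b\<close> with \<open>b = v - u\<close>. These are odd numbers, hence nonzero, hence of one sign.
\<close>

lemma elliptic_member:
  obtains u c a v where "(u, - c, a, v) \<in> C" "of_int (u * v + a * c) = N"
    "0 < v - u \<and> v - u < 2 * a \<and> v - u < 2 * c \<or> v - u < 0 \<and> 2 * a < v - u \<and> 2 * c < v - u"
proof -
  obtain M S where mC: "M \<in> C" and t: "in_triangle S" and d: "pairing S S = 2" and fix_S: "act N M S = S"
    using fixed_minimizer by blast
  obtain p q r where S: "S = (p, q, r)" by (metis surj_pair)
  obtain u y a v where M: "M = (u, y, a, v)" by (metis surj_pair)
  define U Y A V where e: "U = real_of_int u" "Y = real_of_int y" "A = real_of_int a" "V = real_of_int v"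
  have dd: "p * r - q * q = 1" using d unfolding S by auto
  have "p \<ge> 0" "r \<ge> 0" "q \<ge> 0" "p \<noteq> 0" "r \<noteq> 0" using t dd unfolding S by auto
  then have pos: "p > 0" "r > 0" "q \<ge> 0" by auto
  have o: "odd a" "odd y" "odd (u + v)" using rot[OF mC] M by auto
  define D where "D = U * V - Y * A"
  have D: "D = N \<or> D = - N" using det[OF mC] unfolding M D_def e
    by (simp add: power2_eq_iff flip: of_int_mult of_int_diff)
  have eqs: "N * p = U^2 * p - 2 * U * Y * q + Y^2 * r"
     "N * q = (U * V + Y * A) * q - U * A * p - Y * V * r"
     "N * r = A^2 * p - 2 * A * V * q + V^2 * r"
    using fix_S N_pos unfolding S M e by (auto simp: field_simps)
  have lin: "D * (U * p - Y * q) = N * p * V + N * q * Y"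
     "D * (- U * q + Y * r) = - (N * p * A) - N * q * U"
     "D * (- A * q + V * r) = N * q * A + N * r * U"
    unfolding eqs D_def by (simp_all add: algebra_simps power2_eq_square)
  have "D \<noteq> - N"
  proof
    assume "D = - N"
    then have "N * ((U + V) * p) = 0" using lin(1) by (simp add: algebra_simps)
    then have "real_of_int (u + v) = 0" using N_pos pos unfolding e by simp
    then show False using o by (metis of_int_eq_0_iff even_zero)
  qed
  then have DN: "D = N" using D by simp
  have l1: "(V - U) * p = - 2 * Y * q"
  proof -
    have "N * ((V - U) * p + 2 * Y * q) = 0" using lin(1) unfolding DN by (simp add: algebra_simps)
    then show ?thesis using N_pos by simp
  qed
  have l2: "Y * r = - A * p"
  proof -
    have "N * (Y * r + A * p) = 0" using lin(2) unfolding DN by (simp add: algebra_simps)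
    then show ?thesis using N_pos by simp
  qed
  define \<tau> where "\<tau> = A / r"
  have A: "A = \<tau> * r" using pos by (simp add: \<tau>_def)
  have Y: "- Y = \<tau> * p" using l2 pos by (simp add: \<tau>_def field_simps)
  have B: "V - U = 2 * \<tau> * q"
  proof -
    have "(V - U) * p = (2 * \<tau> * q) * p" using l1 arg_cong[OF Y, of "\<lambda>x. 2 * q * x"] by (simp add: algebra_simps)
    then show ?thesis using pos by simp
  qed
  have par: "2 * A - (V - U) = 2 * \<tau> * (r - q)" "2 * (- Y) - (V - U) = 2 * \<tau> * (p - q)"
    unfolding B Y unfolding A by (simp_all add: algebra_simps)
  have tt: "r - q \<ge> 0" "p - q \<ge> 0" "q \<ge> 0" using t unfolding S by auto
  have ne: "v - u \<noteq> 0" "2 * a - (v - u) \<noteq> 0" "2 * (- y) - (v - u) \<noteq> 0" using o by presburger+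
  have cases: "0 < v - u \<and> v - u < 2 * a \<and> v - u < 2 * (- y) \<or> v - u < 0 \<and> 2 * a < v - u \<and> 2 * (- y) < v - u"
  proof (cases "\<tau> \<ge> 0")
    case True
    then have "V - U \<ge> 0" "2 * A - (V - U) \<ge> 0" "2 * (- Y) - (V - U) \<ge> 0" unfolding par using tt B by auto
    then have "v - u \<ge> 0" "2 * a - (v - u) \<ge> 0" "2 * (- y) - (v - u) \<ge> 0" unfolding e by linarith+
    then show ?thesis using ne by linarith
  next
    case False
    then have "V - U \<le> 0" "2 * A - (V - U) \<le> 0" "2 * (- Y) - (V - U) \<le> 0"
      unfolding par using tt B by (auto simp: mult_le_0_iff)
    then have "v - u \<le> 0" "2 * a - (v - u) \<le> 0" "2 * (- y) - (v - u) \<le> 0" unfolding e by linarith+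
    then show ?thesis using ne by linarith
  qed
  show thesis
    by (rule that[of u "- y" a v]) (use mC M DN cases in \<open>auto simp: D_def e algebra_simps\<close>)
qed
end

section \<open>Counting matrices with a fixed point in the triangle\<close>

fun mmul :: "imat \<Rightarrow> imat \<Rightarrow> imat" where
  "mmul (k, l, m, n) (u, y, a, v) = (k * u + l * a, k * y + l * v, m * u + n * a, m * y + n * v)"

fun adjugate :: "imat \<Rightarrow> imat" where
  "adjugate (u, y, a, v) = (v, - y, - a, u)"

lemma idet_mmul: "idet (mmul G M) = idet G * idet M"
  by (cases G; cases M) (simp add: algebra_simps)
lemma mmul_assoc: "mmul (mmul G H) M = mmul G (mmul H M)"
  by (cases G; cases H; cases M) (simp add: algebra_simps)
lemma mmul_adjugate: "idet G = 1 \<Longrightarrow> mmul (adjugate G) (mmul G M) = M"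
proof (cases G; cases M)
  fix k l m n u y a v assume g: "idet G = 1" "G = (k, l, m, n)" "M = (u, y, a, v)"
  have "n * (k * x + l * z) - l * (m * x + n * z) = idet G * x" "k * (m * x + n * z) - m * (k * x + l * z) = idet G * z" for x z
    unfolding g(2) by (simp_all add: algebra_simps)
  then show ?thesis unfolding g(1) using g(2,3) by simp
qed
lemma idet_adjugate: "idet (adjugate G) = idet G"
  by (cases G) (simp add: algebra_simps)

text \<open>
The Hermite normal form of a matrix of determinant \<open>N\<close>, described by its lower diagonal entry \<open>e\<close> and
its upper right entry \<open>k < e\<close>.
\<close>

fun upper :: "int \<Rightarrow> nat \<times> nat \<Rightarrow> imat" where
  "upper N (e, k) = (N div int e, int k, 0, int e)"

text \<open>
The fixed point of the matrix lies in the interior of the ideal triangle, by the coordinates in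
\<open>elliptic_member\<close>. Of the two matrices \<open>\<plusminus>M\<close> with the same fixed point, only one qualifies.
\<close>

fun elliptic :: "imat \<Rightarrow> bool" where
  "elliptic (u, y, a, v) \<longleftrightarrow> 0 < v - u \<and> v - u < 2 * a \<and> v - u < 2 * (- y)"

text \<open>
A rotating matrix reduces modulo \<open>2\<close> to one of two matrices, which the parity of \<open>u\<close> tells apart.
\<close>

fun parity_class :: "imat \<Rightarrow> bool" where
  "parity_class (u, y, a, v) = even u"

text \<open>
Let \<open>S\<close> and \<open>S'\<close> be the fixed points of \<open>M\<close> and \<open>G M\<close>. As \<open>M\<close> is an isometry, \<open>S\<close> has the same pairing
with \<open>S'\<close> as with \<open>G\<^sup>-\<^sup>1 S'\<close>. In triangle coordinates \<open>p\<^sub>i\<close>, \<open>q\<^sub>j\<close> both pairings are combinations of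
the products \<open>p\<^sub>i q\<^sub>j\<close>, with coefficients \<open>(\<xi>\<^sub>i \<and> \<xi>\<^sub>j)\<^sup>2\<close> and \<open>(\<xi>\<^sub>i \<and> G\<^sup>-\<^sup>1 \<xi>\<^sub>j)\<^sup>2\<close>. The former
are \<open>1\<close> off the diagonal and \<open>0\<close> on it. The latter are odd squares off the diagonal and even squares on
it, because \<open>G\<close> is trivial modulo \<open>2\<close>. As the \<open>p\<^sub>i\<close> and \<open>q\<^sub>j\<close> are positive, all coefficients agree,
and \<open>G\<close> fixes the cusps.
\<close>

lemma elliptic_rigid:
  assumes "elliptic M" "elliptic (mmul G M)" "idet G = 1"
    and G: "G = (k, l, m, n)" "odd k" "odd n" "even l" "even m"
  shows "mmul G M = M"
proof -
  obtain u y a v where M: "mmul G M = (u, y, a, v)" by (metis surj_pair)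
  define u' y' a' v' where M'_def: "u' = n * u - l * a" "y' = n * y - l * v" "a' = - m * u + k * a" "v' = - m * y + k * v"
  have M': "M = (u', y', a', v')" using mmul_adjugate[OF assms(3), of M] unfolding M unfolding G M'_def by simp
  define p1 p2 p3 where p: "p1 = - 2 * y' - (v' - u')" "p2 = 2 * a' - (v' - u')" "p3 = v' - u'"
  define q1 q2 q3 where q: "q1 = - 2 * y - (v - u)" "q2 = 2 * a - (v - u)" "q3 = v - u"
  have pos: "p1 > 0" "p2 > 0" "p3 > 0" "q1 > 0" "q2 > 0" "q3 > 0"
    using assms(1,2) unfolding M unfolding M' p q by auto
  have d: "k * n - l * m = 1" using assms(3) G by simp
  have "p1 * q1 * m^2 + p2 * q2 * l^2 + p3 * q3 * (n + l - m - k)^2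
      + p1 * q2 * k^2 + p1 * q3 * (m + k)^2 + p2 * q1 * n^2 + p2 * q3 * (n + l)^2
      + p3 * q1 * (n - m)^2 + p3 * q2 * (k - l)^2
    = (k * n - l * m) * (p1 * q2 + p1 * q3 + p2 * q1 + p2 * q3 + p3 * q1 + p3 * q2)"
    unfolding p q M'_def by (simp add: algebra_simps power2_eq_square)
  then have key: "p1 * q1 * m^2 + p2 * q2 * l^2 + p3 * q3 * (n + l - m - k)^2
      + p1 * q2 * k^2 + p1 * q3 * (m + k)^2 + p2 * q1 * n^2 + p2 * q3 * (n + l)^2
      + p3 * q1 * (n - m)^2 + p3 * q2 * (k - l)^2
    = p1 * q2 + p1 * q3 + p2 * q1 + p2 * q3 + p3 * q1 + p3 * q2" unfolding d by simp
  have ge: "x * z \<le> x * z * w^2" if "x > 0" "z > 0" "odd w" for x z w :: int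
  proof -
    have "x * z * 1 \<le> x * z * w^2" using that one_le_odd_power2[of w] by (intro mult_left_mono) auto
    then show ?thesis by simp
  qed
  have "p1 * q2 \<le> p1 * q2 * k^2" "p1 * q3 \<le> p1 * q3 * (m + k)^2" "p2 * q1 \<le> p2 * q1 * n^2"
    "p2 * q3 \<le> p2 * q3 * (n + l)^2" "p3 * q1 \<le> p3 * q1 * (n - m)^2" "p3 * q2 \<le> p3 * q2 * (k - l)^2"
    by (rule ge; use pos G in simp)+
  moreover have "p1 * q1 * m^2 \<ge> 0" "p2 * q2 * l^2 \<ge> 0" "p3 * q3 * (n + l - m - k)^2 \<ge> 0" using pos by auto
  ultimately have "p1 * q1 * m^2 = 0" "p2 * q2 * l^2 = 0" using key by linarith+
  then have "m = 0" "l = 0" using pos by auto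
  then have "k * n = 1" using d by simp
  then have "k = 1 \<and> n = 1 \<or> k = -1 \<and> n = -1" by (rule zmult_eq_1_iff[THEN iffD1])
  moreover have "n > 0"
  proof (rule ccontr)
    assume "\<not> n > 0"
    then have "n = -1" "k = -1" using \<open>k = 1 \<and> n = 1 \<or> k = -1 \<and> n = -1\<close> by auto
    then have "p3 = - q3" unfolding p q M'_def \<open>m = 0\<close> \<open>l = 0\<close> by simp
    then show False using pos by simp
  qed
  ultimately have "k = 1" "n = 1" by auto
  then show ?thesis unfolding M unfolding M' M'_def \<open>m = 0\<close> \<open>l = 0\<close> by simp
qed

text \<open>
Two rotating matrices in one row-equivalence class and one parity class differ by a factor that is
trivial modulo \<open>2\<close>.
\<close>

lemma elliptic_unique:
  assumes M: "M = mmul G H" "elliptic M" "rotating M" "idet G = 1"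
    and M': "M' = mmul G' H" "elliptic M'" "rotating M'" "idet G' = 1"
    and par: "parity_class M = parity_class M'"
  shows "M = M'"
proof -
  define D where "D = mmul G' (adjugate G)"
  have "mmul D M = M'"
    by (simp only: D_def mmul_assoc M(1) mmul_adjugate[OF M(4)] M'(1))
  have det: "idet D = 1" unfolding D_def idet_mmul idet_adjugate using M(4) M'(4) by simp
  obtain k l m n where D: "D = (k, l, m, n)" by (metis surj_pair)
  obtain u y a v where Me: "M = (u, y, a, v)" by (metis surj_pair)
  obtain u' y' a' v' where Me': "M' = (u', y', a', v')" by (metis surj_pair)
  have e: "u' = k * u + l * a" "y' = k * y + l * v" "a' = m * u + n * a" "v' = m * y + n * v"
    using \<open>mmul D M = M'\<close> unfolding D Me Me' by auto
  have o: "odd a" "odd y" "odd (u + v)" "odd a'" "odd y'" "odd (u' + v')" "even u = even u'"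
    using M(3) M'(3) par unfolding Me Me' by auto
  have "even (k * u + l * a) = even u" "odd (k * y + l * v)" "odd (m * u + n * a)" "even (m * y + n * v) = even v"
    using o unfolding e[symmetric] by auto
  then have "odd k" "odd n" "even l" "even m" using o by auto
  then have "mmul D M = M" using elliptic_rigid[OF M(2) _ det D] M'(2) \<open>mmul D M = M'\<close> by simp
  then show ?thesis using \<open>mmul D M = M'\<close> by simp
qed

lemma hermite_exists:
  assumes "idet M = N" "N > 0"
  obtains G e k where "idet G = 1" "M = mmul G (upper N (e, k))" "int e dvd N" "k < e"
proof -
  obtain p q r s where M: "M = (p, q, r, s)" by (metis surj_pair)
  define d where "d = gcd p r"
  have N: "p * s - q * r = N" using assms M by simp
  then have "d \<noteq> 0" using assms by (auto simp: d_def)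
  then have d: "d > 0" unfolding d_def by (metis gcd_ge_0_int less_le)
  obtain x z where xz: "x * p + z * r = d" using bezout_int[of p r] unfolding d_def by blast
  obtain p' r' where pr: "p = d * p'" "r = d * r'" unfolding d_def by (meson dvdE gcd_dvd1 gcd_dvd2)
  have one: "x * p' + z * r' = 1"
  proof -
    have "d * (x * p' + z * r') = d * 1" using xz unfolding pr by (simp add: algebra_simps)
    then show ?thesis using d by simp
  qed
  define e where "e = p' * s - q * r'"
  have Ne: "N = d * e" using N unfolding pr e_def by (simp add: algebra_simps)
  then have e: "e > 0" using assms d by (simp add: zero_less_mult_iff)
  define t where "t = x * q + z * s"
  define j where "j = t div e"
  define k where "k = t mod e"
  have k: "0 \<le> k" "k < e" "t = k + j * e" using e by (auto simp: k_def j_def)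
  define G where "G = (p', p' * j - z, r', r' * j + x)"
  have det: "idet G = 1" unfolding G_def using one by (simp add: algebra_simps)
  have q: "q = p' * t - z * e" "s = r' * t + x * e"
  proof -
    have "p' * t - z * e = (x * p' + z * r') * q" unfolding t_def e_def by (simp add: algebra_simps)
    then show "q = p' * t - z * e" using one by simp
    have "r' * t + x * e = (x * p' + z * r') * s" unfolding t_def e_def by (simp add: algebra_simps)
    then show "s = r' * t + x * e" using one by simp
  qed
  have "M = mmul G (d, k, 0, e)" unfolding M G_def pr q k(3) by (simp add: algebra_simps)
  also have "(d, k, 0, e) = upper N (nat e, nat k)" using e k Ne by simp
  finally have "M = mmul G (upper N (nat e, nat k))" .
  moreover have "int (nat e) dvd N" "nat k < nat e" using e k Ne by auto
  ultimately show thesis by (rule that[OF det])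
qed

lemma hermite_unique:
  assumes "mmul G (upper N (e, k)) = mmul G' (upper N (e', k'))" "idet G = 1" "idet G' = 1"
    "int e dvd N" "int e' dvd N" "k < e" "k' < e'" "N > 0"
  shows "e = e' \<and> k = k'"
proof -
  define D where "D = mmul (adjugate G') G"
  obtain a b c d where D: "D = (a, b, c, d)" by (metis surj_pair)
  have DH: "mmul D (upper N (e, k)) = upper N (e', k')"
    unfolding D_def mmul_assoc assms(1) mmul_adjugate[OF assms(3)] ..
  have det: "idet D = 1" unfolding D_def idet_mmul idet_adjugate using assms by simp
  obtain f where f: "N = int e * f" using assms(4) by blast
  obtain f' where f': "N = int e' * f'" using assms(5) by blast
  have pos: "int e > 0" "int e' > 0" using assms by auto
  have "upper N (e, k) = (f, int k, 0, int e)" using f pos by simp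
  moreover have "upper N (e', k') = (f', int k', 0, int e')" using f' pos by simp
  ultimately have eq: "a * f = f'" "a * int k + b * int e = int k'" "c * f = 0" "c * int k + d * int e = int e'"
     "a * d - b * c = 1" using DH det unfolding D by auto
  have fpos: "f > 0" "f' > 0" using f f' pos assms(8) by (metis zero_less_mult_pos)+
  then have "c = 0" using eq by simp
  then have "a * d = 1" using eq by simp
  moreover have "a > 0" using eq(1) fpos by (metis zero_less_mult_pos2)
  ultimately have "a = 1" "d = 1" by (auto simp: zmult_eq_1_iff)
  then have "e = e'" using eq \<open>c = 0\<close> by simp
  have "b = 0"
  proof (rule ccontr)
    assume "b \<noteq> 0"
    then consider "b \<ge> 1" | "b \<le> -1" by linarith
    then show False
    proof cases
      case 1
      then have "b * int e \<ge> 1 * int e" using pos by (intro mult_right_mono) auto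
      then show False using eq(2) assms(6,7) unfolding \<open>a = 1\<close> \<open>e = e'\<close> by linarith
    next
      case 2
      then have "b * int e \<le> (-1) * int e" using pos by (intro mult_right_mono) auto
      then show False using eq(2) assms(6,7) unfolding \<open>a = 1\<close> \<open>e = e'\<close> by linarith
    qed
  qed
  then show ?thesis using eq(2) \<open>a = 1\<close> \<open>e = e'\<close> by simp
qed

text \<open>
The fixed point theorem applies to all matrices of the given parity class that arise from the normal
form by left multiplication with integer matrices of determinant \<open>\<plusminus>1\<close>.
\<close>

lemma elliptic_exists:
  assumes "N > 0" "odd N" "int e dvd N" "e > 0"
  obtains G where "idet G = 1" "rotating (mmul G (upper N (e, k)))"
    "elliptic (mmul G (upper N (e, k)))" "parity_class (mmul G (upper N (e, k))) = b"
proof -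
  obtain d where d: "N = int e * d" using assms(3) by blast
  have H: "upper N (e, k) = (d, int k, 0, int e)" using assms d by simp
  have o: "odd d" "odd (int e)" using assms(2) d by auto
  define C where "C = {M. \<exists>G. \<bar>idet G\<bar> = 1 \<and> M = mmul G (upper N (e, k)) \<and> rotating M \<and> parity_class M = b}"
  have dH: "idet (upper N (e, k)) = N" unfolding H using d by simp
  interpret reflection_closed C "of_int N"
  proof
    show "(of_int N :: real) > 0" using assms by simp
    show "C \<noteq> {}"
    proof -
      define G where "G = (if b then (if even k then (0, -1, 1, 1) else (0, -1, 1, 0))
         else (if even k then (1, -1, 1, 0) else (1 :: int, 0, 1, 1)) :: imat)"
      have "\<bar>idet G\<bar> = 1 \<and> rotating (mmul G (upper N (e, k))) \<and> parity_class (mmul G (upper N (e, k))) = b"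
        unfolding G_def H using o by auto
      then show ?thesis unfolding C_def by blast
    qed
    show "(real_of_int (idet M))\<^sup>2 = (real_of_int N)\<^sup>2" if M: "M \<in> C" for M
    proof -
      obtain G where G: "\<bar>idet G\<bar> = 1" "M = mmul G (upper N (e, k))" using M unfolding C_def by blast
      have "idet M = idet G * N" unfolding G(2) idet_mmul dH ..
      then have "idet M = N \<or> idet M = - N" using G(1) by (auto simp: abs_if split: if_splits)
      then show ?thesis by auto
    qed
    show "rotating M" if M: "M \<in> C" for M using M unfolding C_def by auto
    have left: "mmul R M \<in> C" if lM: "M \<in> C" "\<bar>idet R\<bar> = 1" "rotating (mmul R M)" "parity_class (mmul R M) = parity_class M" for M R
    proof -
      obtain G where "\<bar>idet G\<bar> = 1" "M = mmul G (upper N (e, k))" "parity_class M = b" using lM(1) unfolding C_def by blast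
      then have "\<bar>idet (mmul R G)\<bar> = 1" "mmul R M = mmul (mmul R G) (upper N (e, k))"
        using lM(2) by (simp_all only: idet_mmul abs_mult mmul_assoc mult_1_left)
      then show ?thesis using lM(3,4) \<open>parity_class M = b\<close> unfolding C_def by blast
    qed
    fix M assume M: "M \<in> C"
    obtain u y a v where Me: "M = (u, y, a, v)" by (metis surj_pair)
    have r: "odd a" "odd y" "odd (u + v)" using M Me unfolding C_def by auto
    have e: "refl1 M = mmul (-1, 0, 2, 1) M" "refl2 M = mmul (1, 2, 0, -1) M" "refl3 M = mmul (1, 0, 0, -1) M"
      unfolding Me by auto
    show "refl1 M \<in> C" unfolding e by (rule left[OF M]; use r in \<open>simp add: Me\<close>)
    show "refl2 M \<in> C" unfolding e by (rule left[OF M]; use r in \<open>simp add: Me\<close>)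
    show "refl3 M \<in> C" unfolding e by (rule left[OF M]; use r in \<open>simp add: Me\<close>)
  qed
  obtain u c a v where m: "(u, - c, a, v) \<in> C" and D: "real_of_int (u * v + a * c) = of_int N"
    and s: "0 < v - u \<and> v - u < 2 * a \<and> v - u < 2 * c \<or> v - u < 0 \<and> 2 * a < v - u \<and> 2 * c < v - u"
    by (rule elliptic_member)
  obtain G where G: "(u, - c, a, v) = mmul G (upper N (e, k))" "rotating (u, - c, a, v)" "parity_class (u, - c, a, v) = b"
    using m unfolding C_def by blast
  have "idet G * N = N"
    using arg_cong[OF G(1), of idet] D by (simp only: idet_mmul dH of_int_eq_iff) (simp add: algebra_simps)
  then have g: "idet G = 1" using assms(1) by simp
  show thesis
  proof (cases "0 < v - u")
    case True
    then show ?thesis using that[OF g] s G unfolding G(1)[symmetric] by simp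
  next
    case False
    obtain g1 g2 g3 g4 where Ge: "G = (g1, g2, g3, g4)" by (metis surj_pair)
    define G' where "G' = (- g1, - g2, - g3, - g4)"
    have neg: "mmul G' (upper N (e, k)) = (- u, c, - a, - v)"
      using G(1) unfolding G'_def Ge H by auto
    have "idet G' = 1" using g unfolding G'_def Ge by simp
    moreover have "rotating (- u, c, - a, - v)" using G(2) by simp
    moreover have "elliptic (- u, c, - a, - v)" using s False by simp
    moreover have "parity_class (- u, c, - a, - v) = b" using G(3) by simp
    ultimately show ?thesis using that[of G'] unfolding neg by blast
  qed
qed

lemma card_eq_correspondence:
  assumes "\<And>x. x \<in> A \<Longrightarrow> \<exists>!y. y \<in> B \<and> R x y" "\<And>y. y \<in> B \<Longrightarrow> \<exists>!x. x \<in> A \<and> R x y"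
  shows "card A = card B"
proof -
  define f where "f = (\<lambda>x. THE y. y \<in> B \<and> R x y)"
  have f: "f x \<in> B \<and> R x (f x)" if "x \<in> A" for x
    unfolding f_def by (rule theI') (rule assms(1)[OF that])
  have "bij_betw f A B"
  proof (rule bij_betwI')
    fix x y assume xy: "x \<in> A" "y \<in> A"
    show "(f x = f y) = (x = y)" using f[OF xy(1)] f[OF xy(2)] assms(2)[of "f x"] xy by metis
  next
    fix x assume "x \<in> A" then show "f x \<in> B" using f by blast
  next
    fix y assume y: "y \<in> B"
    then obtain x where x: "x \<in> A" "R x y" using assms(2) by blast
    then show "\<exists>x\<in>A. y = f x" using f[OF x(1)] assms(1)[OF x(1)] y by blast
  qed
  then show ?thesis by (rule bij_betw_same_card)
qed

definition elliptics :: "int \<Rightarrow> imat set" where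
  "elliptics N = {M. idet M = N \<and> rotating M \<and> elliptic M}"

text \<open>
For each Hermite normal form and each of the two parity classes there is exactly one elliptic matrix,
and the number of normal forms of determinant \<open>n\<close> is the sum of the divisors of \<open>n\<close>.
\<close>

lemma card_elliptics:
  assumes "odd (n :: nat)"
  shows "card (elliptics (int n)) = 2 * (\<Sum>d | d dvd n. d)"
proof -
  have n: "n > 0" using assms by (cases n) auto
  define I where "I = (SIGMA e:{e. e dvd n}. {..<e}) \<times> (UNIV :: bool set)"
  define R where "R = (\<lambda>M (i, b). \<exists>G. idet G = 1 \<and> M = mmul G (upper (int n) i) \<and> parity_class M = b)"
  have idet_upper: "idet (upper (int n) (e, k)) = int n" if "e dvd n" for e k
    using that n by auto
  have "card (elliptics (int n)) = card I"
  proof (rule card_eq_correspondence[of _ _ R])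
    fix M assume M: "M \<in> elliptics (int n)"
    have "idet M = int n" "int n > 0" using M n unfolding elliptics_def by auto
    then obtain G e k where G: "idet G = 1" "M = mmul G (upper (int n) (e, k))" "int e dvd int n" "k < e"
      by (rule hermite_exists)
    show "\<exists>!i. i \<in> I \<and> R M i"
    proof (rule ex1I[of _ "((e, k), parity_class M)"])
      show "((e, k), parity_class M) \<in> I \<and> R M ((e, k), parity_class M)"
      proof
        show "((e, k), parity_class M) \<in> I" using G unfolding I_def by simp
        show "R M ((e, k), parity_class M)" using G(1,2) unfolding R_def prod.case by blast
      qed
      fix i assume i: "i \<in> I \<and> R M i"
      obtain e' k' b where ib: "i = ((e', k'), b)" by (metis surj_pair)
      obtain G' where G': "idet G' = 1" "M = mmul G' (upper (int n) (e', k'))" "parity_class M = b"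
        using i unfolding ib R_def prod.case by blast
      have "e' = e \<and> k' = k"
        by (rule hermite_unique[of G' "int n" e' k' G]) (use G G' i n in \<open>auto simp: ib I_def\<close>)
      then show "i = ((e, k), parity_class M)" using ib G' by simp
    qed
  next
    fix i assume i: "i \<in> I"
    obtain e k b where ib: "i = ((e, k), b)" by (metis surj_pair)
    have ek: "e dvd n" "k < e" using i unfolding I_def ib by auto
    have pre: "int n > 0" "odd (int n)" "int e dvd int n" "e > 0" using assms n ek by auto
    obtain G where G: "idet G = 1" "rotating (mmul G (upper (int n) (e, k)))"
      "elliptic (mmul G (upper (int n) (e, k)))" "parity_class (mmul G (upper (int n) (e, k))) = b"
      by (rule elliptic_exists[OF pre])
    show "\<exists>!M. M \<in> elliptics (int n) \<and> R M i"
    proof (rule ex1I[of _ "mmul G (upper (int n) (e, k))"])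
      show "mmul G (upper (int n) (e, k)) \<in> elliptics (int n) \<and> R (mmul G (upper (int n) (e, k))) i"
      proof
        show "mmul G (upper (int n) (e, k)) \<in> elliptics (int n)"
          using G idet_upper[OF ek(1), of k] unfolding elliptics_def by (simp only: idet_mmul mem_Collect_eq mult_1_left)
        show "R (mmul G (upper (int n) (e, k))) i" using G(1,4) unfolding R_def ib prod.case by blast
      qed
      fix M assume M: "M \<in> elliptics (int n) \<and> R M i"
      obtain G' where G': "idet G' = 1" "M = mmul G' (upper (int n) (e, k))" "parity_class M = b"
        using M unfolding ib R_def prod.case by blast
      have "elliptic M" "rotating M" using M unfolding elliptics_def by blast+
      then show "M = mmul G (upper (int n) (e, k))"
        by (rule elliptic_unique[OF G'(2) _ _ G'(1) refl G(3,2,1) G'(3)[folded G(4)]])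
    qed
  qed
  also have "card I = 2 * (\<Sum>d | d dvd n. d)"
    using n by (simp add: I_def card_cartesian_product)
  finally show ?thesis .
qed

definition quadruples :: "int \<Rightarrow> (int \<times> int \<times> int \<times> int) set" where
  "quadruples N = {(X, A, B, C). odd X \<and> odd A \<and> odd B \<and> odd C \<and> A > 0 \<and> B > 0 \<and> C > 0 \<and>
      X^2 + A * B + B * C + C * A = 4 * N}"

text \<open>
The quadruple consists of the trace of the matrix and the triangle coordinates of its fixed point.
\<close>

lemma card_quadruples:
  assumes "odd N"
  shows "card (quadruples N) = card (elliptics N)"
proof -
  have "bij_betw (\<lambda>(u, y, a, v). (u + v, 2 * a - (v - u), - 2 * y - (v - u), v - u)) (elliptics N) (quadruples N)"
  proof (rule bij_betw_byWitness[where f' = "\<lambda>(X, A, B, C). ((X - C) div 2, - ((B + C) div 2), (A + C) div 2, (X + C) div 2)"])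
    show "\<forall>M\<in>elliptics N. (\<lambda>(X, A, B, C). ((X - C) div 2, - ((B + C) div 2), (A + C) div 2, (X + C) div 2))
       ((\<lambda>(u, y, a, v). (u + v, 2 * a - (v - u), - 2 * y - (v - u), v - u)) M) = M"
      by auto
    show "\<forall>M\<in>quadruples N. (\<lambda>(u, y, a, v). (u + v, 2 * a - (v - u), - 2 * y - (v - u), v - u))
      ((\<lambda>(X, A, B, C). ((X - C) div 2, - ((B + C) div 2), (A + C) div 2, (X + C) div 2)) M) = M"
      unfolding quadruples_def by (auto elim!: oddE)
    show "(\<lambda>(u, y, a, v). (u + v, 2 * a - (v - u), - 2 * y - (v - u), v - u)) ` elliptics N \<subseteq> quadruples N"
    proof
      fix z assume "z \<in> (\<lambda>(u, y, a, v). (u + v, 2 * a - (v - u), - 2 * y - (v - u), v - u)) ` elliptics N"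
      then obtain u y a v where z: "z = (u + v, 2 * a - (v - u), - 2 * y - (v - u), v - u)"
        and m: "idet (u, y, a, v) = N" "rotating (u, y, a, v)" "elliptic (u, y, a, v)"
        unfolding elliptics_def by auto
      have "(u + v)^2 + (2 * a - (v - u)) * (- 2 * y - (v - u)) + (- 2 * y - (v - u)) * (v - u) + (v - u) * (2 * a - (v - u))
        = 4 * (u * v - y * a)" by (simp add: algebra_simps power2_eq_square)
      then show "z \<in> quadruples N" using m unfolding z quadruples_def by auto
    qed
    show "(\<lambda>(X, A, B, C). ((X - C) div 2, - ((B + C) div 2), (A + C) div 2, (X + C) div 2)) ` quadruples N \<subseteq> elliptics N"
    proof
      fix z assume "z \<in> (\<lambda>(X, A, B, C). ((X - C) div 2, - ((B + C) div 2), (A + C) div 2, (X + C) div 2)) ` quadruples N"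
      then obtain X A B C where z: "z = ((X - C) div 2, - ((B + C) div 2), (A + C) div 2, (X + C) div 2)"
        and o: "odd X" "odd A" "odd B" "odd C" "A > 0" "B > 0" "C > 0"
        and eq: "X^2 + A * B + B * C + C * A = 4 * N" unfolding quadruples_def by auto
      define u c a v where d: "u = (X - C) div 2" "c = (B + C) div 2" "a = (A + C) div 2" "v = (X + C) div 2"
      have d2: "X = u + v" "C = v - u" "A = 2 * a - (v - u)" "B = 2 * c - (v - u)"
        using o unfolding d by (auto elim!: oddE)
      have "4 * (u * v + c * a) = 4 * N" using eq unfolding d2 by (simp add: algebra_simps power2_eq_square)
      then have N: "u * v + c * a = N" by simp
      have uv: "odd (u + v)" using o d2 by simp
      then have "even (u * v)" by auto
      then have "odd (c * a)" using N assms by (metis even_add)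
      then have "odd c" "odd a" by auto
      then show "z \<in> elliptics N" using uv N o unfolding z d[symmetric] elliptics_def d2 by (auto simp: algebra_simps)
    qed
  qed
  from bij_betw_same_card[OF this] show ?thesis by (rule sym)
qed

section \<open>Four triangular numbers and divisor sums\<close>

text \<open>
The equation is the one of Zagier's proof of Fermat's two-square theorem, for numbers that are \<open>5\<close>
modulo \<open>8\<close>.
\<close>

definition windmills :: "nat \<Rightarrow> (int \<times> int \<times> int) set" where
  "windmills n = {(x, d, e). d > 0 \<and> e > 0 \<and> x^2 + 4 * d * e = 8 * int n + 5}"

lemma finite_windmills: "finite (windmills n)"
proof (rule finite_subset)
  let ?M = "8 * int n + 5"
  show "windmills n \<subseteq> {-?M..?M} \<times> {-?M..?M} \<times> {-?M..?M}"
  proof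
    fix t assume "t \<in> windmills n"
    then obtain x d e where t: "t = (x, d, e)" and p: "d > 0" "e > 0" and q: "x^2 + 4 * d * e = ?M"
      unfolding windmills_def by auto
    have "d * 1 \<le> d * e" "1 * e \<le> d * e" using p by (intro mult_mono; simp)+
    moreover have "\<bar>x\<bar> \<le> x^2" by (rule abs_le_power2_int)
    moreover have "x^2 \<ge> 0" "d * e > 0" using p by auto
    moreover have "x^2 + 4 * (d * e) = ?M" using q by simp
    ultimately have "\<bar>x\<bar> \<le> ?M" "d \<le> ?M" "e \<le> ?M" by linarith+
    then show "t \<in> {-?M..?M} \<times> {-?M..?M} \<times> {-?M..?M}" using p unfolding t by auto
  qed
qed auto

lemma windmills_odd:
  assumes "(x, d, e) \<in> windmills n"
  shows "odd x" "odd d" "odd e"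
proof -
  have eq: "x^2 + 4 * d * e = 8 * int n + 5" using assms unfolding windmills_def by auto
  have "odd (x^2 + 4 * d * e)" unfolding eq by simp
  then show "odd x" by simp
  then obtain k where k: "x = 2 * k + 1" by (elim oddE)
  have "4 * (k^2 + k + d * e) = 4 * (2 * int n + 1)" using eq unfolding k by (simp add: power2_eq_square algebra_simps)
  then have "k * (k + 1) + d * e = 2 * int n + 1" by (simp add: power2_eq_square algebra_simps)
  moreover have "even (k * (k + 1))" by simp
  ultimately have "odd (d * e)" by (metis even_add odd_two_times_div_two_succ dvd_triv_left even_plus_one_iff)
  then show "odd d" "odd e" by auto
qed

text \<open>
The polynomial \<open>K\<close> differs from \<open>(d + e) (d e - x\<^sup>2)\<close> by a term odd in \<open>x\<close>, which does not affect the
sum. It is invariant under \<open>(x, d, e) \<mapsto> (-x, e, d)\<close>, which exchanges the two halves of the windmill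
set, and it changes sign under Zagier's involution \<open>(x, d, e) \<mapsto> (2 d - x, d, e + x - d)\<close> of the
half \<open>e + x > d\<close>. So the sum of \<open>K\<close> vanishes, and by the symmetry between \<open>d\<close> and \<open>e\<close> it is twice
the sum in question.
\<close>

lemma windmill_sum: "(\<Sum>(x, d, e)\<in>windmills n. d * (d * e - x^2)) = 0"
proof -
  define S where "S = windmills n"
  have fin: "finite S" unfolding S_def by (rule finite_windmills)
  define K where "K = (\<lambda>(x, d, e). (d + e) * (d * e - x^2) + x * (d^2 - e^2) :: int)"
  define P where "P = {t \<in> S. case t of (x, d, e) \<Rightarrow> e + x - d > 0}"
  define Q where "Q = {t \<in> S. case t of (x, d, e) \<Rightarrow> e + x - d < 0}"
  have ne: "e + x - d \<noteq> 0" if "(x, d, e) \<in> S" for x d e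
  proof -
    have "odd x" "odd d" "odd e" using windmills_odd that unfolding S_def by blast+
    then have "odd (e + x - d)" by simp
    then show ?thesis by auto
  qed
  have SPQ: "S = P \<union> Q" "P \<inter> Q = {}"
    using ne unfolding P_def Q_def by (auto simp: linorder_neq_iff)
  have "sum K Q = sum K P"
    by (rule sum.reindex_bij_witness[of _ "\<lambda>(x, d, e). (- x, e, d)" "\<lambda>(x, d, e). (- x, e, d)"])
       (auto simp: P_def Q_def S_def windmills_def K_def algebra_simps power2_eq_square)
  moreover have "sum K P = sum (\<lambda>t. - K t) P"
    by (rule sum.reindex_bij_witness[of _ "\<lambda>(x, d, e). (2 * d - x, d, e + x - d)" "\<lambda>(x, d, e). (2 * d - x, d, e + x - d)"])
       (auto simp: P_def S_def windmills_def K_def algebra_simps power2_eq_square)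
  then have "sum K P = 0" by (simp add: sum_negf)
  ultimately have K0: "sum K S = 0" using SPQ fin by (simp add: sum.union_disjoint)
  have "(\<Sum>(x, d, e)\<in>S. x * (d^2 - e^2)) = (\<Sum>(x, d, e)\<in>S. - (x * (d^2 - e^2)))"
    by (rule sum.reindex_bij_witness[of _ "\<lambda>(x, d, e). (- x, d, e)" "\<lambda>(x, d, e). (- x, d, e)"])
       (auto simp: S_def windmills_def)
  then have odd0: "(\<Sum>(x, d, e)\<in>S. x * (d^2 - e^2)) = 0" by (simp add: sum_negf case_prod_unfold)
  have swap: "(\<Sum>(x, d, e)\<in>S. e * (d * e - x^2)) = (\<Sum>(x, d, e)\<in>S. d * (d * e - x^2))"
    by (rule sum.reindex_bij_witness[of _ "\<lambda>(x, d, e). (x, e, d)" "\<lambda>(x, d, e). (x, e, d)"])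
       (auto simp: S_def windmills_def algebra_simps)
  have "sum K S = (\<Sum>(x, d, e)\<in>S. d * (d * e - x^2)) + (\<Sum>(x, d, e)\<in>S. e * (d * e - x^2))
     + (\<Sum>(x, d, e)\<in>S. x * (d^2 - e^2))"
    unfolding K_def sum.distrib[symmetric] by (intro sum.cong) (auto simp: algebra_simps)
  then show ?thesis using K0 odd0 swap unfolding S_def by simp
qed

definition tri :: "nat \<Rightarrow> nat" where "tri k = k * (k + 1) div 2"

lemma eight_tri: "8 * int (tri k) + 1 = (2 * int k + 1)^2"
proof -
  have "2 * tri k = k * (k + 1)" unfolding tri_def by simp
  then have "2 * int (tri k) = int k * (int k + 1)" by (metis of_nat_mult of_nat_numeral of_nat_add of_nat_1)
  then show ?thesis by (simp add: power2_eq_square algebra_simps)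
qed

lemma tri_0: "tri 0 = 0" by (simp add: tri_def)

lemma tri_ge: "k \<le> tri k" by (cases k) (auto simp: tri_def)

lemma inj_tri: "inj tri"
proof (rule injI)
  fix i j assume "tri i = tri j"
  then have "(2 * int i + 1)^2 = (2 * int j + 1)^2" using eight_tri by metis
  then show "i = j" by (simp add: power2_eq_iff_nonneg)
qed

lemma finite_tri: "finite {k. tri k \<le> n}"
  by (rule finite_subset[of _ "{..n}"]) (use tri_ge order_trans in auto)

text \<open>
The theta series of the triangular numbers. Its powers count representations by triangular numbers.
\<close>

definition tri_fps :: "int fps" where
  "tri_fps = Abs_fps (\<lambda>n. if n \<in> range tri then 1 else 0)"

lemma tri_fps_mult_nth: "(tri_fps * f) $ n = (\<Sum>k | tri k \<le> n. f $ (n - tri k))"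
proof -
  have "(tri_fps * f) $ n = (\<Sum>j\<in>{0..n}. if j \<in> range tri then f $ (n - j) else 0)"
    unfolding fps_mult_nth tri_fps_def by (intro sum.cong) auto
  also have "\<dots> = (\<Sum>j\<in>{0..n} \<inter> range tri. f $ (n - j))"
    by (simp add: sum.inter_restrict)
  also have "{0..n} \<inter> range tri = tri ` {k. tri k \<le> n}" by auto
  also have "(\<Sum>j\<in>\<dots>. f $ (n - j)) = (\<Sum>k | tri k \<le> n. f $ (n - tri k))"
    by (subst sum.reindex) (auto intro: inj_on_subset[OF inj_tri])
  finally show ?thesis .
qed

lemma tri_sum_cong: "(\<Sum>j\<le>n. tri_fps $ j * f j) = (\<Sum>k | tri k \<le> n. f (tri k))"
proof -
  have "(\<Sum>j\<le>n. tri_fps $ j * f j) = (tri_fps * Abs_fps (\<lambda>i. f (n - i))) $ n"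
    unfolding fps_mult_nth by (intro sum.cong) (auto simp: atMost_atLeast0)
  also have "\<dots> = (\<Sum>k | tri k \<le> n. f (tri k))"
    unfolding tri_fps_mult_nth by (intro sum.cong) auto
  finally show ?thesis .
qed

definition sigma_fps :: "int fps" where
  "sigma_fps = Abs_fps (\<lambda>n. \<Sum>d | d dvd 2 * n + 1. int d)"

text \<open>
With \<open>x = 2 k + 1\<close> and \<open>d e = 2 (n - tri k) + 1\<close> one has \<open>x\<^sup>2 + 4 d e = 8 n + 5\<close> and
\<open>d e - x\<^sup>2 = 2 (n - 5 tri k)\<close>, so this is the windmill sum restricted to \<open>x > 0\<close>.
\<close>

lemma sigma_recurrence: "(\<Sum>k | tri k \<le> n. (int n - 5 * int (tri k)) * sigma_fps $ (n - tri k)) = 0"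
proof -
  define P where "P = {t \<in> windmills n. fst t > 0}"
  define Q where "Q = {t \<in> windmills n. fst t < 0}"
  define F where "F = (\<lambda>(x, d, e). d * (d * e - x^2) :: int)"
  have "windmills n = P \<union> Q" "P \<inter> Q = {}"
    using windmills_odd unfolding P_def Q_def by (auto, metis even_zero linorder_neqE_linordered_idom)
  moreover have "sum F Q = sum F P"
    by (rule sum.reindex_bij_witness[of _ "\<lambda>(x, d, e). (- x, d, e)" "\<lambda>(x, d, e). (- x, d, e)"])
       (auto simp: P_def Q_def windmills_def F_def)
  moreover have "finite P" "finite Q" unfolding P_def Q_def using finite_windmills by auto
  ultimately have "2 * sum F P = sum F (windmills n)" by (simp add: sum.union_disjoint)
  then have P0: "sum F P = 0" using windmill_sum[of n] unfolding F_def by simp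
  have "(\<Sum>k | tri k \<le> n. (int n - 5 * int (tri k)) * sigma_fps $ (n - tri k))
    = (\<Sum>k | tri k \<le> n. \<Sum>d | d dvd 2 * (n - tri k) + 1. (int n - 5 * int (tri k)) * int d)"
    by (simp add: sigma_fps_def sum_distrib_left)
  also have "\<dots> = (\<Sum>(k, d)\<in>(SIGMA k:{k. tri k \<le> n}. {d. d dvd 2 * (n - tri k) + 1}). (int n - 5 * int (tri k)) * int d)"
    by (rule sum.Sigma) (auto simp: finite_tri)
  finally have 1: "2 * (\<Sum>k | tri k \<le> n. (int n - 5 * int (tri k)) * sigma_fps $ (n - tri k)) =
     (\<Sum>(k, d)\<in>(SIGMA k:{k. tri k \<le> n}. {d. d dvd 2 * (n - tri k) + 1}). 2 * ((int n - 5 * int (tri k)) * int d))"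
    by (simp add: sum_distrib_left case_prod_unfold)
  also have "\<dots> = sum F P"
  proof (rule sum.reindex_bij_witness[of _ "\<lambda>(x, d, e). (nat ((x - 1) div 2), nat d)"
        "\<lambda>(k, d). (2 * int k + 1, int d, int ((2 * (n - tri k) + 1) div d))"])
    fix t assume "t \<in> (SIGMA k:{k. tri k \<le> n}. {d. d dvd 2 * (n - tri k) + 1})"
    then obtain k d where t: "t = (k, d)" and k: "tri k \<le> n" and d: "d dvd 2 * (n - tri k) + 1" by auto
    then obtain e where e: "2 * (n - tri k) + 1 = d * e" by blast
    then have pos: "d > 0" "e > 0" by (cases d; simp; cases e; simp)+
    have m: "2 * (int n - int (tri k)) + 1 = int d * int e" using e k
      by (metis (no_types, lifting) of_nat_1 of_nat_add of_nat_diff of_nat_mult of_nat_numeral)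
    have dv: "(2 * (n - tri k) + 1) div d = e" using e pos by simp
    show "(\<lambda>(x, d, e). (nat ((x - 1) div 2), nat d)) ((\<lambda>(k, d). (2 * int k + 1, int d, int ((2 * (n - tri k) + 1) div d))) t) = t"
      unfolding t by simp
    have "(2 * int k + 1)^2 + 4 * int d * int e = 8 * int n + 5"
      unfolding eight_tri[symmetric] using m by (simp add: algebra_simps)
    then show "(\<lambda>(k, d). (2 * int k + 1, int d, int ((2 * (n - tri k) + 1) div d))) t \<in> P"
      unfolding t prod.case dv P_def windmills_def using pos by simp
    show "F ((\<lambda>(k, d). (2 * int k + 1, int d, int ((2 * (n - tri k) + 1) div d))) t) =
       (\<lambda>(k, d). 2 * ((int n - 5 * int (tri k)) * int d)) t"
      unfolding t prod.case dv F_def eight_tri[symmetric] m[symmetric] by (simp add: algebra_simps)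
  next
    fix t assume "t \<in> P"
    then obtain x d e where t: "t = (x, d, e)" and w: "(x, d, e) \<in> windmills n" and x: "x > 0" unfolding P_def by (cases t) auto
    have pos: "d > 0" "e > 0" and eq: "x^2 + 4 * d * e = 8 * int n + 5" using w unfolding windmills_def by auto
    obtain j where j: "x = 2 * j + 1" using windmills_odd(1)[OF w] by (elim oddE)
    define k where "k = nat j"
    have k: "x = 2 * int k + 1" using j x unfolding k_def by simp
    have tk: "8 * int (tri k) + 1 + 4 * (d * e) = 8 * int n + 5" using eq unfolding k eight_tri by simp
    then have le: "int (tri k) \<le> int n" using mult_pos_pos[OF pos] by linarith
    have m: "int (2 * (n - tri k) + 1) = d * e" using tk le by (simp add: of_nat_diff)
    have m': "2 * (n - tri k) + 1 = nat d * nat e" using m pos by (metis nat_int nat_mult_distrib less_imp_le)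
    have b: "(x - 1) div 2 = int k" unfolding k by simp
    show "(\<lambda>(k, d). (2 * int k + 1, int d, int ((2 * (n - tri k) + 1) div d))) ((\<lambda>(x, d, e). (nat ((x - 1) div 2), nat d)) t) = t"
      unfolding t prod.case b nat_int m' using pos k by simp
    show "(\<lambda>(x, d, e). (nat ((x - 1) div 2), nat d)) t \<in> (SIGMA k:{k. tri k \<le> n}. {d. d dvd 2 * (n - tri k) + 1})"
      unfolding t prod.case b nat_int using m' le by simp
  qed
  finally show ?thesis using P0 by simp
qed

text \<open>
This is the coefficient form of the differential equation \<open>\<theta> f' = 4 \<theta>' f\<close> of \<open>f = \<theta>\<^sup>4\<close>.
\<close>

lemma fourth_power_recurrence:
  "(\<Sum>k | tri k \<le> n. (int n - 5 * int (tri k)) * (tri_fps^4) $ (n - tri k)) = 0"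
proof -
  define D where "D = (\<lambda>f :: int fps. fps_X * fps_deriv f)"
  have D: "D f $ m = int m * f $ m" for f m by (cases m) (auto simp: D_def)
  have "fps_deriv (tri_fps^4) = 4 * fps_deriv tri_fps * tri_fps^3"
    by (simp add: fps_deriv_power numeral_fps_const)
  then have "tri_fps * D (tri_fps^4) = 4 * (D tri_fps * tri_fps^4)"
    unfolding D_def by (simp add: power4_eq_xxxx power3_eq_cube algebra_simps)
  then have "(tri_fps * D (tri_fps^4)) $ n = 4 * (D tri_fps * tri_fps^4) $ n"
    by (simp add: numeral_fps_const)
  moreover have "(D tri_fps * tri_fps^4) $ n = (\<Sum>j\<le>n. tri_fps $ j * (int j * (tri_fps^4) $ (n - j)))"
    unfolding fps_mult_nth D by (intro sum.cong) (auto simp: atMost_atLeast0)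
  moreover have "(tri_fps * D (tri_fps^4)) $ n = (\<Sum>k | tri k \<le> n. (int n - int (tri k)) * (tri_fps^4) $ (n - tri k))"
    unfolding tri_fps_mult_nth D by (intro sum.cong) (auto simp: of_nat_diff)
  ultimately have "(\<Sum>k | tri k \<le> n. (int n - int (tri k)) * (tri_fps^4) $ (n - tri k)) =
      (\<Sum>k | tri k \<le> n. 4 * (int (tri k) * (tri_fps^4) $ (n - tri k)))"
    unfolding tri_sum_cong by (simp add: sum_distrib_left)
  then have "(\<Sum>k | tri k \<le> n. (int n - int (tri k)) * (tri_fps^4) $ (n - tri k) - 4 * (int (tri k) * (tri_fps^4) $ (n - tri k))) = 0"
    by (simp add: sum_subtractf)
  then show ?thesis by (simp add: algebra_simps)
qed

text \<open>
Both series satisfy the same recurrence, which determines a series by its constant term. This is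
Legendre's formula for the number of representations by four triangular numbers.
\<close>

lemma sigma_fps_eq: "sigma_fps = tri_fps^4"
proof (rule fps_ext)
  fix n
  show "sigma_fps $ n = (tri_fps^4) $ n"
  proof (induction n rule: less_induct)
    case (less n)
    show ?case
    proof (cases "n = 0")
      case True
      have "0 \<in> range tri" using tri_0 by (metis rangeI)
      then have "tri_fps $ 0 = 1" by (simp add: tri_fps_def)
      then show ?thesis using True by (simp add: sigma_fps_def fps_nth_power_0)
    next
      case False
      have split: "(\<Sum>k | tri k \<le> n. (int n - 5 * int (tri k)) * f $ (n - tri k)) =
         int n * f $ n + (\<Sum>k | tri k \<le> n \<and> k \<noteq> 0. (int n - 5 * int (tri k)) * f $ (n - tri k))" for f :: "int fps"
      proof -
        have "{k. tri k \<le> n} = insert 0 {k. tri k \<le> n \<and> k \<noteq> 0}" using tri_0 by auto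
        then show ?thesis using finite_tri[of n] by (simp add: tri_0)
      qed
      have "(\<Sum>k | tri k \<le> n \<and> k \<noteq> 0. (int n - 5 * int (tri k)) * sigma_fps $ (n - tri k)) =
         (\<Sum>k | tri k \<le> n \<and> k \<noteq> 0. (int n - 5 * int (tri k)) * (tri_fps^4) $ (n - tri k))"
      proof (rule sum.cong)
        fix k assume "k \<in> {k. tri k \<le> n \<and> k \<noteq> 0}"
        then have "n - tri k < n" using False tri_ge[of k] by auto
        then show "(int n - 5 * int (tri k)) * sigma_fps $ (n - tri k) = (int n - 5 * int (tri k)) * (tri_fps^4) $ (n - tri k)"
          using less by simp
      qed simp
      then have "int n * sigma_fps $ n = int n * (tri_fps^4) $ n"
        using sigma_recurrence[of n] fourth_power_recurrence[of n] unfolding split by linarith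
      then show ?thesis using False by simp
    qed
  qed
qed

section \<open>Three triangular numbers\<close>

text \<open>
With \<open>a = (A + C) / 2\<close>, \<open>b = C\<close>, \<open>c = (B + C) / 2\<close> these are the integral binary quadratic forms of
discriminant \<open>b\<^sup>2 - 4 a c = - (8 m + 3)\<close> whose point lies in the ideal triangle.
\<close>

definition triples :: "nat \<Rightarrow> (int \<times> int \<times> int) set" where
  "triples m = {(A, B, C). odd A \<and> odd B \<and> odd C \<and> A > 0 \<and> B > 0 \<and> C > 0 \<and>
     A * B + B * C + C * A = 8 * int m + 3}"

definition triple_fps :: "int fps" where
  "triple_fps = Abs_fps (\<lambda>m. int (card (triples m)))"

lemma finite_triples: "finite (triples m)"
proof (rule finite_subset)
  let ?M = "8 * int m + 3"
  show "triples m \<subseteq> {0..?M} \<times> {0..?M} \<times> {0..?M}"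
  proof
    fix t assume "t \<in> triples m"
    then obtain A B C where t: "t = (A, B, C)" and p: "A > 0" "B > 0" "C > 0" and q: "A * B + B * C + C * A = ?M"
      unfolding triples_def by auto
    have "A * 1 \<le> A * B" "B * 1 \<le> B * C" "C * 1 \<le> C * A" using p by (intro mult_left_mono; simp)+
    then have "A \<le> ?M" "B \<le> ?M" "C \<le> ?M" using q p by (smt (verit) mult_pos_pos)+
    then show "t \<in> {0..?M} \<times> {0..?M} \<times> {0..?M}" using p unfolding t by auto
  qed
qed auto

lemma card_triples_pos: "card (triples m) > 0"
proof -
  have "(1, 1, 4 * int m + 1) \<in> triples m" unfolding triples_def by simp
  then show ?thesis using finite_triples card_gt_0_iff by blast
qed

text \<open>
Splitting the quadruples by the absolute value \<open>2 k + 1\<close> of their first entry shows that the product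
counts half of them.
\<close>

lemma triangular_times_triples: "tri_fps * triple_fps = sigma_fps"
proof (rule fps_ext)
  fix n
  define N where "N = int (2 * n + 1)"
  define P where "P = {t \<in> quadruples N. fst t > 0}"
  define Q where "Q = {t \<in> quadruples N. fst t < 0}"
  have P: "bij_betw (\<lambda>(k, t). (2 * int k + 1, t)) (SIGMA k:{k. tri k \<le> n}. triples (n - tri k)) P"
  proof (rule bij_betw_byWitness[where f' = "\<lambda>(x, t). (nat ((x - 1) div 2), t)"])
    show "\<forall>p\<in>SIGMA k:{k. tri k \<le> n}. triples (n - tri k).
       (\<lambda>(x, t). (nat ((x - 1) div 2), t)) ((\<lambda>(k, t). (2 * int k + 1, t)) p) = p" by auto
    show "\<forall>q\<in>P. (\<lambda>(k, t). (2 * int k + 1, t)) ((\<lambda>(x, t). (nat ((x - 1) div 2), t)) q) = q"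
      unfolding P_def quadruples_def by (auto elim!: oddE)
    show "(\<lambda>(k, t). (2 * int k + 1, t)) ` (SIGMA k:{k. tri k \<le> n}. triples (n - tri k)) \<subseteq> P"
      unfolding P_def quadruples_def triples_def N_def eight_tri[symmetric]
      by (auto simp: eight_tri[symmetric] of_nat_diff)
    show "(\<lambda>(x, t). (nat ((x - 1) div 2), t)) ` P \<subseteq> (SIGMA k:{k. tri k \<le> n}. triples (n - tri k))"
    proof
      fix z assume "z \<in> (\<lambda>(x, t). (nat ((x - 1) div 2), t)) ` P"
      then obtain x A B C where z: "z = (nat ((x - 1) div 2), A, B, C)" and x: "x > 0" "odd x"
        and o: "odd A" "odd B" "odd C" "A > 0" "B > 0" "C > 0"
        and eq: "x^2 + A * B + B * C + C * A = 4 * N"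
        unfolding P_def quadruples_def by auto
      obtain j where j: "x = 2 * j + 1" using x by (elim oddE)
      define k where "k = nat j"
      have k: "x = 2 * int k + 1" using j x unfolding k_def by simp
      have e: "8 * int (tri k) + 1 + (A * B + B * C + C * A) = 8 * int n + 4"
        using eq unfolding k eight_tri N_def by simp
      have "A * B > 0" "B * C > 0" "C * A > 0" using o by auto
      then have le: "tri k \<le> n" using e by linarith
      have "nat ((x - 1) div 2) = k" unfolding k by simp
      then show "z \<in> (SIGMA k:{k. tri k \<le> n}. triples (n - tri k))"
        using o e le unfolding z triples_def by (simp add: of_nat_diff)
    qed
  qed
  have finS: "finite (SIGMA k:{k. tri k \<le> n}. triples (n - tri k))"
    using finite_tri finite_triples by auto
  then have finP: "finite P" using P bij_betw_finite by blast
  have PQ: "bij_betw (\<lambda>(x, t). (- x, t)) P Q"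
    by (rule bij_betw_byWitness[where f' = "\<lambda>(x, t). (- x, t)"]) (auto simp: P_def Q_def quadruples_def)
  have "quadruples N = P \<union> Q" "P \<inter> Q = {}"
    unfolding P_def Q_def quadruples_def by (auto simp: linorder_neq_iff, metis even_zero linorder_neqE_linordered_idom)
  then have "card (quadruples N) = card P + card Q"
    using finP bij_betw_finite[OF PQ] by (simp add: card_Un_disjoint)
  also have "card Q = card P" using bij_betw_same_card[OF PQ] by simp
  also have "card P = (\<Sum>k | tri k \<le> n. card (triples (n - tri k)))"
    using bij_betw_same_card[OF P] finite_tri finite_triples by simp
  finally have "card (quadruples N) = 2 * (\<Sum>k | tri k \<le> n. card (triples (n - tri k)))" by simp
  moreover have "card (quadruples N) = 2 * (\<Sum>d | d dvd 2 * n + 1. d)"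
    using card_quadruples[of N] card_elliptics[of "2 * n + 1"] unfolding N_def by simp
  ultimately have "(\<Sum>k | tri k \<le> n. card (triples (n - tri k))) = (\<Sum>d | d dvd 2 * n + 1. d)" by simp
  then show "(tri_fps * triple_fps) $ n = sigma_fps $ n"
    unfolding tri_fps_mult_nth sigma_fps_def triple_fps_def by (simp flip: of_nat_sum)
qed

text \<open>
Multiplied by the theta series, both sides give the generating function of the divisor sums.
\<close>

lemma triple_fps_eq: "triple_fps = tri_fps^3"
proof -
  have "0 \<in> range tri" using tri_0 by (metis rangeI)
  then have "tri_fps $ 0 = 1" by (simp add: tri_fps_def)
  then have "tri_fps \<noteq> 0" by auto
  moreover have "tri_fps * triple_fps = tri_fps * tri_fps^3"
    unfolding triangular_times_triples sigma_fps_eq by (simp add: power4_eq_xxxx power3_eq_cube mult.assoc)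
  ultimately show ?thesis by simp
qed

text \<open>
Gauss's Eureka theorem. The triple \<open>(1, 1, 4 n + 1)\<close> shows that the coefficients of the cube of the theta
series are positive.
\<close>

theorem sum_of_three_triangular: "\<exists>i j k. n = tri i + tri j + tri k"
proof -
  have "(tri_fps * (tri_fps * tri_fps)) $ n \<noteq> 0"
    using card_triples_pos[of n] arg_cong[OF triple_fps_eq, of "\<lambda>f. f $ n"]
    by (simp add: triple_fps_def power3_eq_cube mult.assoc)
  then obtain i where i: "tri i \<le> n" "(tri_fps * tri_fps) $ (n - tri i) \<noteq> 0"
    unfolding tri_fps_mult_nth[of "tri_fps * tri_fps"] by (metis (mono_tags, lifting) mem_Collect_eq sum.neutral)
  then obtain j where j: "tri j \<le> n - tri i" "tri_fps $ (n - tri i - tri j) \<noteq> 0"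
    unfolding tri_fps_mult_nth by (metis (mono_tags, lifting) mem_Collect_eq sum.neutral)
  then obtain k where "n - tri i - tri j = tri k" unfolding tri_fps_def by (auto split: if_splits)
  then have "n = tri i + tri j + tri k" using i j by simp
  then show ?thesis by blast
qed

lemma signed_triangular: "\<exists>m :: int. int (tri k) = m * (2 * m + 1)"
proof -
  have t: "2 * int (tri k) = int k * (int k + 1)" using eight_tri[of k] by (simp add: power2_eq_square algebra_simps)
  show ?thesis
  proof (cases "even k")
    case True
    then obtain m where m: "int k = 2 * m" by (metis evenE even_of_nat)
    then show ?thesis using t by (intro exI[of _ m]) (simp add: algebra_simps)
  next
    case False
    then obtain m where m: "int k = 2 * m + 1" by (metis oddE even_of_nat)
    then show ?thesis using t by (intro exI[of _ "- m - 1"]) (simp add: algebra_simps)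
  qed
qed

text \<open>
If \<open>n = \<Sum> m\<^sub>i (2 m\<^sub>i + 1)\<close>, then \<open>8 n + 3\<close> is the sum of the squares of \<open>X\<^sub>i = 4 m\<^sub>i + 1\<close>, and the four
integers are \<open>(1 \<plusminus> X\<^sub>1 \<plusminus> X\<^sub>2 \<plusminus> X\<^sub>3) / 4\<close> with an even number of minus signs.
\<close>

lemma four_integers: 
  obtains x y z w :: int where "x + y + z + w = 1" "x^2 + y^2 + z^2 + w^2 = 2 * int n + 1"
proof -
  obtain i j k where n: "n = tri i + tri j + tri k" using sum_of_three_triangular by blast
  obtain a where a: "int (tri i) = a * (2 * a + 1)" using signed_triangular by blast
  obtain b where b: "int (tri j) = b * (2 * b + 1)" using signed_triangular by blast
  obtain c where c: "int (tri k) = c * (2 * c + 1)" using signed_triangular by blast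
  have n': "int n = a * (2 * a + 1) + b * (2 * b + 1) + c * (2 * c + 1)" using n a b c by simp
  show thesis
    by (rule that[of "1 + a + b + c" "a - b - c" "b - a - c" "c - a - b"])
       (simp_all add: n' algebra_simps power2_eq_square)
qed

section \<open>Ranks and sums of squares\<close>

lemma rk_Y_eq: "rk_Y l \<sigma> = int l * (\<Sum>i\<in>{1..l}. (\<sigma> i)^2) - (\<Sum>i\<in>{1..l}. \<sigma> i)^2"
proof -
  have "rk_Y l \<sigma> = (\<Sum>i\<in>{1..l}. \<Sum>j\<in>{1..l}. \<sigma> i * (\<sigma> i - \<sigma> j))"
    unfolding rk_Y_def by (intro sum.cong refl sum.mono_neutral_left) auto
  also have "\<dots> = (\<Sum>i\<in>{1..l}. int l * (\<sigma> i)^2 - \<sigma> i * (\<Sum>j\<in>{1..l}. \<sigma> j))"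
    by (intro sum.cong) (auto simp: right_diff_distrib sum_subtractf sum_distrib_left power2_eq_square)
  also have "\<dots> = int l * (\<Sum>i\<in>{1..l}. (\<sigma> i)^2) - (\<Sum>i\<in>{1..l}. \<sigma> i)^2"
    by (simp add: sum_subtractf power2_eq_square flip: sum_distrib_left sum_distrib_right)
  finally show ?thesis .
qed

text \<open>
With \<open>Q\<close> the sum of squares, the quotient in the definition of the rank is
\<open>(Q - 1) / 2 - (s\<^sup>2 - 1) / (2 l)\<close>. Since \<open>Q\<close> has the parity of \<open>s\<close>, this is \<open>(Q - 1) / 2\<close> exactly for \<open>s = 1\<close>,
and for \<open>s = 0\<close> it is \<open>Q / 2\<close> plus a number in \<open>(-1/2, 0]\<close>.
\<close>

lemma rk_eq_iff:
  assumes "l \<ge> 1" "(\<Sum>i\<in>{1..l}. \<sigma> i) = s" "s = 0 \<or> s = 1"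
  shows "rk l \<sigma> = int n \<longleftrightarrow> (\<Sum>i\<in>{1..l}. (\<sigma> i)^2) = 2 * int n + s"
proof -
  define Q where "Q = (\<Sum>i\<in>{1..l}. (\<sigma> i)^2)"
  have "even (Q - s)"
  proof -
    have "Q - s = (\<Sum>i\<in>{1..l}. (\<sigma> i)^2 - \<sigma> i)" unfolding Q_def assms(2)[symmetric] by (simp add: sum_subtractf)
    also have "even \<dots>" by (rule dvd_sum) simp
    finally show ?thesis .
  qed
  then obtain q where q: "Q = 2 * q + s" by (metis dvdE diff_eq_eq)
  have L: "real l \<ge> 1" using assms(1) by simp
  have "rk l \<sigma> = q"
  proof -
    have "real_of_int (rk_Y l \<sigma> - int l + 1) = real l * (2 * q + s) - s - l + 1"
      unfolding rk_Y_eq Q_def[symmetric] assms(2) q using assms(3) by auto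
    then have v: "real_of_int (rk_Y l \<sigma> - int l + 1) / (2 * real l) = (real l * (2 * q + s) - s - l + 1) / (2 * real l)"
      by simp
    show ?thesis unfolding rk_def v
      by (rule ceiling_unique) (use assms(3) L in \<open>auto simp: field_simps\<close>)
  qed
  then show ?thesis unfolding Q_def[symmetric] q by simp
qed

lemma finite_bounded_vecs:
  "finite {\<sigma> \<in> int_vecs l. (\<Sum>i\<in>{1..l}. (\<sigma> i)^2) = M}"
proof (rule finite_subset)
  show "{\<sigma> \<in> int_vecs l. (\<Sum>i\<in>{1..l}. (\<sigma> i)^2) = M} \<subseteq> ({1..l} \<rightarrow>\<^sub>E {-M..M})"
  proof
    fix \<sigma> assume s: "\<sigma> \<in> {\<sigma> \<in> int_vecs l. (\<Sum>i\<in>{1..l}. (\<sigma> i)^2) = M}"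
    have "\<sigma> i \<in> {-M..M}" if "i \<in> {1..l}" for i
    proof -
      have "(\<sigma> i)^2 \<le> (\<Sum>i\<in>{1..l}. (\<sigma> i)^2)" using that by (intro member_le_sum) auto
      then have "(\<sigma> i)^2 \<le> M" using s by simp
      then show ?thesis using abs_le_power2_int[of "\<sigma> i"] by auto
    qed
    then show "\<sigma> \<in> ({1..l} \<rightarrow>\<^sub>E {-M..M})" using s unfolding int_vecs_def by (auto simp: PiE_iff)
  qed
qed (auto intro: finite_PiE)

lemma rank_count_pos_iff:
  assumes "l \<ge> 1" "s = 0 \<or> s = 1"
  shows "rank_count l s n > 0 \<longleftrightarrow>
    (\<exists>\<sigma> :: nat \<Rightarrow> int. (\<Sum>i\<in>{1..l}. \<sigma> i) = s \<and> (\<Sum>i\<in>{1..l}. (\<sigma> i)^2) = 2 * int n + s)"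
proof -
  define S where "S = {\<sigma> \<in> int_vecs l. (\<Sum>i\<in>{1..l}. \<sigma> i) = s \<and> rk l \<sigma> = int n}"
  have S: "S = {\<sigma> \<in> int_vecs l. (\<Sum>i\<in>{1..l}. \<sigma> i) = s \<and> (\<Sum>i\<in>{1..l}. (\<sigma> i)^2) = 2 * int n + s}"
    unfolding S_def using rk_eq_iff[OF assms(1) _ assms(2)] by blast
  have "finite S" unfolding S by (rule finite_subset[OF _ finite_bounded_vecs[of l "2 * int n + s"]]) auto
  then have "rank_count l s n > 0 \<longleftrightarrow> S \<noteq> {}" unfolding rank_count_def S_def[symmetric] by (simp add: card_gt_0_iff)
  also have "\<dots> \<longleftrightarrow> (\<exists>\<sigma> :: nat \<Rightarrow> int. (\<Sum>i\<in>{1..l}. \<sigma> i) = s \<and> (\<Sum>i\<in>{1..l}. (\<sigma> i)^2) = 2 * int n + s)"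
  proof
    assume "\<exists>\<sigma> :: nat \<Rightarrow> int. (\<Sum>i\<in>{1..l}. \<sigma> i) = s \<and> (\<Sum>i\<in>{1..l}. (\<sigma> i)^2) = 2 * int n + s"
    then obtain \<sigma> :: "nat \<Rightarrow> int" where e: "(\<Sum>i\<in>{1..l}. \<sigma> i) = s" "(\<Sum>i\<in>{1..l}. (\<sigma> i)^2) = 2 * int n + s" by blast
    have "restrict \<sigma> {1..l} \<in> S" unfolding S int_vecs_def using e by simp
    then show "S \<noteq> {}" by blast
  qed (auto simp: S)
  finally show ?thesis .
qed

lemma sum_padded:
  fixes f :: "nat \<Rightarrow> int"
  assumes "m \<le> l" "\<And>i. i > m \<Longrightarrow> f i = 0"
  shows "(\<Sum>i\<in>{1..l}. f i) = (\<Sum>i\<in>{1..m}. f i)"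
  using assms by (intro sum.mono_neutral_right) auto

lemma sum_1_5: "(\<Sum>i\<in>{1..5 :: nat}. f i) = f 1 + f 2 + f 3 + f 4 + (f 5 :: int)"
  "(\<Sum>i\<in>{1..4 :: nat}. f i) = f 1 + f 2 + f 3 + (f 4 :: int)"
  "(\<Sum>i\<in>{1..3 :: nat}. f i) = f 1 + f 2 + (f 3 :: int)"
  by (simp_all add: numeral_eq_Suc)

lemma no_seven:
  fixes x y z :: int
  assumes "x^2 + y^2 + z^2 = 7"
  shows False
proof -
  have z: "x^2 \<ge> 0" "y^2 \<ge> 0" "z^2 \<ge> 0" by auto
  have b: "\<bar>w\<bar> \<le> 2" if "w^2 \<le> 7" for w :: int
  proof (rule ccontr)
    assume "\<not> \<bar>w\<bar> \<le> 2"
    then have "\<bar>w\<bar>^2 \<ge> 3^2" by (intro power_mono) auto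
    then show False using that by simp
  qed
  have c: "w^2 = 0 \<or> w^2 = 1 \<or> w^2 = 4" if "w^2 \<le> 7" for w :: int
  proof -
    have "w \<in> {-2, -1, 0, 1, 2}" using b[OF that] by auto
    then show ?thesis by auto
  qed
  have "x^2 \<le> 7" "y^2 \<le> 7" "z^2 \<le> 7" using assms z by linarith+
  then show False using c[of x] c[of y] c[of z] assms by linarith
qed

lemma no_twenty_eight:
  fixes x y z :: int
  assumes "x^2 + y^2 + z^2 = 28"
  shows False
proof -
  have m: "w^2 mod 4 = (if even w then 0 else 1)" for w :: int
  proof (cases "even w")
    case True
    then obtain b where "w = 2 * b" by (elim evenE)
    then show ?thesis by simp
  next
    case False
    then obtain b where "w = 2 * b + 1" by (elim oddE)
    then have "w^2 = 1 + 4 * (b^2 + b)" by (simp add: power2_eq_square algebra_simps)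
    then show ?thesis using False by (simp only: mod_mult_self2) simp
  qed
  have "(a mod 4 + b mod 4 + c mod 4) mod 4 = 0" if "a + b + c = 28" for a b c :: int
    using that by presburger
  from this[OF assms]
  have "even x" "even y" "even z" unfolding m by (auto split: if_splits)
  then obtain a b c where "x = 2 * a" "y = 2 * b" "z = 2 * c" by (auto elim!: evenE)
  then have "a^2 + b^2 + c^2 = 7" using assms by simp
  then show False by (rule no_seven)
qed

text \<open>
Two missed values show the failures. The number \<open>7\<close> is not a sum of three squares, which excludes
sum \<open>1\<close> and rank \<open>3\<close> for \<open>l \<le> 3\<close>. For four integers with sum \<open>0\<close> the sum of squares is also the sum of the squares of
the three pairwise sums of the first three of them, and \<open>28\<close> is not a sum of three squares either,
which excludes sum \<open>0\<close> and rank \<open>14\<close> for \<open>l \<le> 4\<close>.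
\<close>

theorem theorem4p4:
  fixes l :: nat
  assumes "l \<ge> 1"
  shows "((\<forall>n. rank_count l 1 n > 0) \<longleftrightarrow> l \<ge> 4) \<and>
         ((\<forall>n. rank_count l 0 n > 0) \<longleftrightarrow> l \<ge> 5)"
proof
  have iff1: "rank_count l 1 n > 0 \<longleftrightarrow>
      (\<exists>\<sigma> :: nat \<Rightarrow> int. (\<Sum>i\<in>{1..l}. \<sigma> i) = 1 \<and> (\<Sum>i\<in>{1..l}. (\<sigma> i)^2) = 2 * int n + 1)" for n
    using rank_count_pos_iff[OF assms, of 1 n] by simp
  have iff0: "rank_count l 0 n > 0 \<longleftrightarrow>
      (\<exists>\<sigma> :: nat \<Rightarrow> int. (\<Sum>i\<in>{1..l}. \<sigma> i) = 0 \<and> (\<Sum>i\<in>{1..l}. (\<sigma> i)^2) = 2 * int n)" for n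
    using rank_count_pos_iff[OF assms, of 0 n] by simp
  show "(\<forall>n. rank_count l 1 n > 0) \<longleftrightarrow> l \<ge> 4"
  proof
    assume "\<forall>n. rank_count l 1 n > 0"
    then obtain \<sigma> :: "nat \<Rightarrow> int" where s: "(\<Sum>i\<in>{1..l}. (\<sigma> i)^2) = 7"
      using iff1[of 3] by auto
    show "l \<ge> 4"
    proof (rule ccontr)
      assume "\<not> l \<ge> 4"
      define \<tau> where "\<tau> = (\<lambda>i. if i \<le> l then \<sigma> i else 0)"
      have "(\<Sum>i\<in>{1..3}. (\<tau> i)^2) = (\<Sum>i\<in>{1..l}. (\<tau> i)^2)"
        by (rule sum_padded) (use \<open>\<not> l \<ge> 4\<close> in \<open>auto simp: \<tau>_def\<close>)
      also have "\<dots> = 7" using s unfolding \<tau>_def by simp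
      finally show False using no_seven unfolding sum_1_5 by blast
    qed
  next
    assume l: "l \<ge> 4"
    show "\<forall>n. rank_count l 1 n > 0"
    proof
      fix n
      obtain x y z w :: int where e: "x + y + z + w = 1" "x^2 + y^2 + z^2 + w^2 = 2 * int n + 1"
        by (rule four_integers)
      define \<sigma> where "\<sigma> = (\<lambda>i :: nat. if i = 1 then x else if i = 2 then y else if i = 3 then z else if i = 4 then w else 0)"
      have "(\<Sum>i\<in>{1..l}. \<sigma> i) = (\<Sum>i\<in>{1..4}. \<sigma> i)" "(\<Sum>i\<in>{1..l}. (\<sigma> i)^2) = (\<Sum>i\<in>{1..4}. (\<sigma> i)^2)"
        by (rule sum_padded[OF l]; simp add: \<sigma>_def)+
      then have "(\<Sum>i\<in>{1..l}. \<sigma> i) = 1" "(\<Sum>i\<in>{1..l}. (\<sigma> i)^2) = 2 * int n + 1"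
        unfolding sum_1_5 using e by (simp_all add: \<sigma>_def)
      then show "rank_count l 1 n > 0" unfolding iff1 by blast
    qed
  qed
  show "(\<forall>n. rank_count l 0 n > 0) \<longleftrightarrow> l \<ge> 5"
  proof
    assume "\<forall>n. rank_count l 0 n > 0"
    then obtain \<sigma> :: "nat \<Rightarrow> int" where s: "(\<Sum>i\<in>{1..l}. \<sigma> i) = 0" "(\<Sum>i\<in>{1..l}. (\<sigma> i)^2) = 28"
      using iff0[of 14] by auto
    show "l \<ge> 5"
    proof (rule ccontr)
      assume "\<not> l \<ge> 5"
      define \<tau> where "\<tau> = (\<lambda>i. if i \<le> l then \<sigma> i else 0)"
      have "(\<Sum>i\<in>{1..4}. (\<tau> i)^2) = (\<Sum>i\<in>{1..l}. (\<tau> i)^2)" "(\<Sum>i\<in>{1..4}. \<tau> i) = (\<Sum>i\<in>{1..l}. \<tau> i)"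
        by (rule sum_padded; use \<open>\<not> l \<ge> 5\<close> in \<open>auto simp: \<tau>_def\<close>)+
      moreover have "(\<Sum>i\<in>{1..l}. (\<tau> i)^2) = 28" "(\<Sum>i\<in>{1..l}. \<tau> i) = 0" using s unfolding \<tau>_def by simp_all
      ultimately have e: "(\<tau> 1)^2 + (\<tau> 2)^2 + (\<tau> 3)^2 + (\<tau> 4)^2 = 28" "\<tau> 4 = - \<tau> 1 - \<tau> 2 - \<tau> 3"
        unfolding sum_1_5 by simp_all
      have "(\<tau> 1 + \<tau> 2)^2 + (\<tau> 1 + \<tau> 3)^2 + (\<tau> 2 + \<tau> 3)^2 = 28"
        using e(1) unfolding e(2) by (simp add: power2_eq_square algebra_simps)
      then show False by (rule no_twenty_eight)
    qed
  next
    assume l: "l \<ge> 5"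
    show "\<forall>n. rank_count l 0 n > 0"
    proof
      fix n
      show "rank_count l 0 n > 0"
      proof (cases n)
        case 0
        then show ?thesis unfolding iff0 by (intro exI[of _ "\<lambda>_. 0"]) simp
      next
        case (Suc m)
        obtain x y z w :: int where e: "x + y + z + w = 1" "x^2 + y^2 + z^2 + w^2 = 2 * int m + 1"
          by (rule four_integers)
        define \<sigma> where "\<sigma> = (\<lambda>i :: nat. if i = 1 then x else if i = 2 then y else if i = 3 then z
            else if i = 4 then w else if i = 5 then -1 else 0)"
        have "(\<Sum>i\<in>{1..l}. \<sigma> i) = (\<Sum>i\<in>{1..5}. \<sigma> i)" "(\<Sum>i\<in>{1..l}. (\<sigma> i)^2) = (\<Sum>i\<in>{1..5}. (\<sigma> i)^2)"
          by (rule sum_padded[OF l]; simp add: \<sigma>_def)+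
        then have "(\<Sum>i\<in>{1..l}. \<sigma> i) = 0" "(\<Sum>i\<in>{1..l}. (\<sigma> i)^2) = 2 * int n"
          unfolding sum_1_5 using e Suc by (simp_all add: \<sigma>_def)
        then show ?thesis unfolding iff0 by blast
      qed
    qed
  qed
qed

end
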